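(* Fix $s\in\mathbb{R}$. As $n\to\infty$, the probability measures $[\![ H_n^*(\cdot; s/n)]\!]_n$ converge weakly to a probability measure $\mu^{(s)}$ on $\mathbb{C}$ which is uniquely characterized by the following properties: (a) If $s\ge 0$, then $\mu^{(s)}$ is supported on a compact subset of $(0,\infty)$. (b) If $s\le 0$, then $\mu^{(s)}$ is supported on the unit circle $\{|z|=1\}$. (c) For every $s\in\mathbb{R}$, $\mu^{(s)}$ is invariant with respect to the map $z\mapsto 1/z$. (d) For every $s\in\mathbb{R}$ and every $k\in\mathbb{N}$, $$\int_{\mathbb{C}} x^k\,\mu^{(s)}(dx)=\frac{e^{sk/2}}{k}[u^{k-1}]\left((1+u)^k e^{sku}\right)=\frac{e^{sk/2}}{k}\sum_{j=0}^{k-1}\binom{k}{j+1}\frac{(sk)^j}{j!}=\frac{e^{sk/2}}{k}L_{k-1}^{(1)}(-ks).$$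
   Context: $\mathbb{N}=\{1,2,\dots\}$, $\mathbb{N}_0=\{0,1,2,\dots\}$. For $n\in\mathbb{N}_0$ and $s\in\mathbb{C}$ the multiplicative Hermite polynomials are $$H_n^*(x;s):=e^{-\frac s2((x\partial_x)^2-nx\partial_x)}(x-1)^n=\sum_{j=0}^n(-1)^{n-j}\binom nj e^{-\frac s2(j^2-nj)}x^j ,$$ where the operator acts on monomials by $x^j\mapsto e^{-\frac s2(j^2-nj)}x^j$. For a polynomial $P\in\mathbb{C}[x]$ of degree $n\in\mathbb{N}$, its zero distribution is the probability measure $[\![P]\!]_n:=\frac1n\sum_{z\in\mathbb{C}:P(z)=0}\delta_z$ on $\mathbb{C}$, zeros counted with multiplicity. $[u^m]f(u)$ denotes the coefficient of $u^m$ in the Taylor series of $f$ at $0$. The associated Laguerre polynomials are $L_n^{(\alpha)}(x)=\sum_{j=0}^n\binom{n+\alpha}{n-j}\frac{(-x)^j}{j!}$. *)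

theory Defs
  imports
    "HOL-Probability.Probability"
    "HOL-Complex_Analysis.Complex_Analysis"
    "HOL-Computational_Algebra.Computational_Algebra"
begin

(* The operator exp (-s/2 ((x d/dx)^2 - n x d/dx)) on polynomials, given by its action
   x^j |-> exp (-s/2 (j^2 - n j)) x^j on monomials. *)
definition mult_heat :: "nat \<Rightarrow> complex \<Rightarrow> complex poly \<Rightarrow> complex poly" where
  "mult_heat n s P =
     (\<Sum>j\<le>degree P. monom (exp (- (s / 2) * (of_nat j ^ 2 - of_nat n * of_nat j)) * coeff P j) j)"

definition mult_hermite :: "nat \<Rightarrow> complex \<Rightarrow> complex poly" where
  "mult_hermite n s = mult_heat n s ([:-1, 1:] ^ n)"

lemma coeff_mult_heat:
  "coeff (mult_heat n s P) j = exp (- (s / 2) * (of_nat j ^ 2 - of_nat n * of_nat j)) * coeff P j"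
  by (auto simp: mult_heat_def coeff_sum not_le coeff_eq_0)

lemma mult_hermite_altdef:
  "mult_hermite n s =
     (\<Sum>j\<le>n. monom ((-1) ^ (n - j) * of_nat (n choose j) *
                    exp (- (s / 2) * (of_nat j ^ 2 - of_nat n * of_nat j))) j)"
proof (rule poly_eqI)
  fix j
  have "coeff ([:-1, 1:] ^ n :: complex poly) j =
          (if j \<le> n then of_nat (n choose j) * (-1) ^ (n - j) else 0)"
    using coeff_linear_poly_power[of j n "-1 :: complex" 1]
    by (auto simp: not_le coeff_eq_0 degree_linear_power)
  then show "coeff (mult_hermite n s) j = coeff
     (\<Sum>j\<le>n. monom ((-1) ^ (n - j) * of_nat (n choose j) *
                    exp (- (s / 2) * (of_nat j ^ 2 - of_nat n * of_nat j))) j) j"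
    by (auto simp: mult_hermite_def coeff_mult_heat coeff_sum)
qed

lemma degree_mult_hermite: "degree (mult_hermite n s) = n"
proof (rule antisym)
  show "degree (mult_hermite n s) \<le> n"
    by (intro degree_le) (auto simp: mult_hermite_altdef coeff_sum)
  have "coeff (mult_hermite n s) n = 1"
    by (simp add: mult_hermite_altdef coeff_sum power2_eq_square)
  then show "n \<le> degree (mult_hermite n s)"
    by (intro le_degree) auto
qed

(* The multiset proots P lists the zeros of P with multiplicity, so this is 1/n times the sum
   of the Dirac measures at the zeros; it is meant for n = degree P. *)
definition zero_distr :: "nat \<Rightarrow> complex poly \<Rightarrow> complex measure" where
  "zero_distr n P =
     measure_of UNIV (sets borel) (\<lambda>A. ennreal (1 / real n) * (\<Sum>z\<in>#proots P. indicator A z))"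

lemma sets_zero_distr [simp, measurable_cong]: "sets (zero_distr n P) = sets borel"
  unfolding zero_distr_def by (metis sets.sets_measure_of_eq space_borel)

lemma space_zero_distr [simp]: "space (zero_distr n P) = UNIV"
  by (simp add: zero_distr_def space_measure_of_conv)

lemma emeasure_zero_distr:
  assumes "A \<in> sets borel"
  shows   "emeasure (zero_distr n P) A = ennreal (1 / real n) * (\<Sum>z\<in>#proots P. indicator A z)"
proof (rule emeasure_measure_of[OF zero_distr_def])
  show "countably_additive (sets (zero_distr n P))
          (\<lambda>A. ennreal (1 / real n) * (\<Sum>z\<in>#proots P. indicator A z))"
  proof (rule countably_additiveI)
    fix A :: "nat \<Rightarrow> complex set"
    assume disj: "disjoint_family A"
    have "(\<Sum>i. \<Sum>z\<in>#M. indicator (A i) z) = (\<Sum>z\<in>#M. indicator (\<Union>i. A i) z :: ennreal)" for M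
      by (induction M) (auto simp: suminf_add[symmetric] suminf_indicator[OF disj])
    then show "(\<Sum>i. ennreal (1 / real n) * (\<Sum>z\<in>#proots P. indicator (A i) z)) =
               ennreal (1 / real n) * (\<Sum>z\<in>#proots P. indicator (\<Union>i. A i) z)"
      by (simp add: ennreal_suminf_cmult)
  qed
qed (use assms in \<open>auto simp: positive_def\<close>)

lemma prob_space_zero_distr:
  assumes "degree P = n" "n > 0"
  shows   "prob_space (zero_distr n P)"
proof
  have "emeasure (zero_distr n P) UNIV = ennreal (1 / real n) * of_nat (size (proots P))"
    by (simp add: emeasure_zero_distr)
  also have "\<dots> = 1"
    using assms by (simp add: size_proots_complex ennreal_of_nat_eq_real_of_nat
                         ennreal_mult[symmetric])
  finally show "emeasure (zero_distr n P) (space (zero_distr n P)) = 1"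
    by simp
qed

(* The library's weak_conv_m is restricted to measures on the real line. *)
definition weakly_converges ::
    "(nat \<Rightarrow> 'a::topological_space measure) \<Rightarrow> 'a measure \<Rightarrow> bool" where
  "weakly_converges M N \<longleftrightarrow>
     (\<forall>f :: 'a \<Rightarrow> real. continuous_on UNIV f \<and> bounded (range f) \<longrightarrow>
        (\<lambda>n. integral\<^sup>L (M n) f) \<longlonglongrightarrow> integral\<^sup>L N f)"

definition laguerre :: "nat \<Rightarrow> 'a::field_char_0 \<Rightarrow> 'a \<Rightarrow> 'a" where
  "laguerre n \<alpha> x = (\<Sum>j=0..n. ((of_nat n + \<alpha>) gchoose (n - j)) * (- x) ^ j / fact j)"

(* The coefficient of u^m in the Taylor series of f at 0. *)
abbreviation taylor_coeff :: "nat \<Rightarrow> (complex \<Rightarrow> complex) \<Rightarrow> complex" where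
  "taylor_coeff m f \<equiv> fps_nth (fps_expansion f 0) m"

(* The support conditions imply that 0 is a null set, so HOL's convention 1 / 0 = 0 does not
   affect the invariance under z |-> 1 / z. Integrability of z^k is explicit because integral\<^sup>L
   is 0 for non-integrable functions. *)
definition limit_properties :: "real \<Rightarrow> complex measure \<Rightarrow> bool" where
  "limit_properties s \<mu> \<longleftrightarrow>
     (s \<ge> 0 \<longrightarrow> (\<exists>K :: real set. compact K \<and> K \<subseteq> {0<..} \<and>
                   (AE z in \<mu>. z \<in> complex_of_real ` K))) \<and>
     (s \<le> 0 \<longrightarrow> (AE z in \<mu>. cmod z = 1)) \<and>
     distr \<mu> borel (\<lambda>z. 1 / z) = \<mu> \<and>
     (\<forall>k\<ge>1.
        integrable \<mu> (\<lambda>z. z ^ k) \<and>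
        (let c = exp (complex_of_real s * of_nat k / 2) / of_nat k;
             t = complex_of_real s * of_nat k
         in  integral\<^sup>L \<mu> (\<lambda>z. z ^ k)
               = c * taylor_coeff (k - 1) (\<lambda>u. (1 + u) ^ k * exp (t * u)) \<and>
             c * taylor_coeff (k - 1) (\<lambda>u. (1 + u) ^ k * exp (t * u))
               = c * (\<Sum>j=0..k-1. of_nat (k choose (j + 1)) * t ^ j / fact j) \<and>
             c * (\<Sum>j=0..k-1. of_nat (k choose (j + 1)) * t ^ j / fact j)
               = c * laguerre (k - 1) 1 (- t)))"

end

theory Submission
  imports Defs
begin

text \<open>
  Write P for the n-th polynomial at parameter s / n, and z for its zeros. The proof has three
  independent inputs: where the zeros are, what their normalised power sums tend to, and why
  these two facts force weak convergence.

  Zeros. With \<theta> = x d/dx, the operator exp (s/(2n) \<theta> (n - \<theta>)) is the limit of the m-th powers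
  of 1 + e \<theta> (n - \<theta>) for e = s / (2nm), and this quadratic in \<theta> splits into two factors \<theta> + c.
  At a point where p does not vanish, (\<theta> + c) p = 0 says that the sum of x / (x - a) over the
  zeros a of p equals -c. For e > 0 the numbers c are real and lie outside [-n, 0], and the
  imaginary part of the sum (for non-real x) or its range (for x \<le> 0) excludes every x outside
  the positive reals. For small e < 0 the real part of c is -n/2, and the real part of the sum
  excludes every x off the unit circle. Hence both factors preserve the location of
  the zeros of (x - 1)^n, and so does the limit (mult_hermite_pos_roots and
  mult_hermite_circle_roots).

  Power sums. Up to a rescaling of the variable, the product of the factors 1 - z x is the
  solution at time s of the heat equation F_t = - \<theta>^2 F / (2n) with F = (1 + x)^n at time 0.
  Its logarithmic derivative \<psi> = \<theta> F / (n F) generates the power sums and satisfies the viscous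
  Burgers equation \<psi>_t = - \<theta>^2 \<psi> / (2n) - \<theta> (\<psi>^2) / 2. Read coefficientwise this is a
  triangular system of ordinary differential equations, so the viscosity can be removed
  by induction on the index (log_deriv_coeff_uniform_limit). The resulting inviscid system is
  solved by the stated Taylor coefficients, an instance of Lagrange inversion
  (fps_lagrange_inversion and burgers_coeff_has_derivative).

  Convergence. The zeros lie on the image of the real line under exp (\<omega> r) with \<omega> = 1 or
  \<omega> = i, so Helly's theorem applies to the real measures of the exponents r. Bounded moments
  give tightness and allow passing to the limit in the moments, and the symmetry r to -r
  carries the invariance under inversion to the limit. Every
  subsequential limit therefore has the asserted properties
  (hermite_subsequence_limit and limit_properties_of_limit). These determine the measure, by the
  Stone-Weierstrass theorem on a compact interval or on the circle (limit_properties_unique), so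
  all subsequential limits agree.
\<close>

section \<open>Lagrange inversion\<close>

text \<open>
  In the language of Laurent series this says that f^(j-k) f' has residue 0 for j + 1 \<noteq> k, being a
  derivative, and residue 1 for j + 1 = k. Multiplying by the k-th power of \<phi> = x / f
  clears the denominators, so that the argument stays within power series.
\<close>
lemma fps_residue_inverse_function:
  fixes \<phi> f :: "'a::field_char_0 fps"
  assumes f: "f * \<phi> = fps_X" and \<phi>: "\<phi> $ 0 \<noteq> 0" and j: "j < k"
  shows "(f ^ j * fps_deriv f * \<phi> ^ k) $ (k - 1) = (if Suc j = k then 1 else 0)"
proof -
  define m where "m = k - Suc j"
  have k: "k = j + Suc m" using j by (simp add: m_def)
  have D: "fps_deriv f * \<phi> + f * fps_deriv \<phi> = 1"
    using arg_cong[OF f, of fps_deriv] by (simp add: add.commute mult.commute)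
  \<comment> \<open>Cancelling f \<phi> = x leaves the m-th coefficient of a series with m = k - j - 1.\<close>
  have "f ^ j * fps_deriv f * \<phi> ^ k = (f * \<phi>) ^ j * (fps_deriv f * \<phi>) * \<phi> ^ m"
    by (simp add: k power_add power_mult_distrib mult_ac)
  also have "\<dots> = fps_X ^ j * (\<phi> ^ m - f * fps_deriv \<phi> * \<phi> ^ m)"
  proof -
    have "fps_deriv f * \<phi> = 1 - f * fps_deriv \<phi>" using D by (metis add_diff_cancel_right')
    then show ?thesis by (simp add: f left_diff_distrib mult.assoc)
  qed
  finally have *: "(f ^ j * fps_deriv f * \<phi> ^ k) $ (k - 1) =
      (\<phi> ^ m - f * fps_deriv \<phi> * \<phi> ^ m) $ m"
    by (simp add: k fps_X_power_mult_nth)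
  show ?thesis
  proof (cases m)
    case 0
    have "f $ 0 = 0" using arg_cong[OF f, of "\<lambda>h. fps_nth h 0"] \<phi> by simp
    then show ?thesis using * 0 k by simp
  next
    case (Suc l)
    \<comment> \<open>Up to the factor m the second term is x d/dx (\<phi>^m), whose m-th coefficient is m times that of \<phi>^m.\<close>
    have "of_nat m * (f * fps_deriv \<phi> * \<phi> ^ m) = fps_X * fps_deriv (\<phi> ^ m)"
    proof -
      have "fps_deriv (\<phi> ^ m) = of_nat m * fps_deriv \<phi> * \<phi> ^ l"
        using fps_deriv_power'[of \<phi> m] Suc by (simp add: mult_ac)
      moreover have "\<phi> ^ m = \<phi> * \<phi> ^ l" by (simp add: Suc)
      ultimately show ?thesis unfolding f[symmetric] by (simp only: mult_ac)
    qed
    then have "of_nat m * (f * fps_deriv \<phi> * \<phi> ^ m) $ m = (fps_X * fps_deriv (\<phi> ^ m)) $ m"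
      by (metis fps_mult_left_const_nth fps_of_nat)
    also have "\<dots> = of_nat m * (\<phi> ^ m) $ m"
      by (simp only: fps_X_mult_nth fps_deriv_nth Suc) simp
    finally have "(f * fps_deriv \<phi> * \<phi> ^ m) $ m = (\<phi> ^ m) $ m"
      using Suc by (metis mult_cancel_left of_nat_eq_0_iff nat.simps(3))
    then show ?thesis using * Suc k by simp
  qed
qed

text \<open>
  Since f starts in degree 1, only finitely many terms of the composition reach the n-th
  coefficient. The common bound N makes it possible to exchange the two sums.
\<close>
lemma fps_compose_mult_nth_truncate:
  fixes h f B :: "'a::field fps"
  assumes "f $ 0 = 0" "n \<le> N"
  shows "((h oo f) * B) $ n = (\<Sum>i\<le>N. h $ i * (f ^ i * B) $ n)"
proof -
  have "(h oo f) $ l = (\<Sum>i\<le>N. h $ i * (f ^ i) $ l)" if "l \<le> n" for l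
    unfolding fps_compose_nth using that assms startsby_zero_power_prefix[OF assms(1)]
    by (intro sum.mono_neutral_left) auto
  then have "((h oo f) * B) $ n = (\<Sum>l=0..n. (\<Sum>i\<le>N. h $ i * (f ^ i) $ l) * B $ (n - l))"
    by (simp add: fps_mult_nth)
  also have "\<dots> = (\<Sum>i\<le>N. h $ i * (f ^ i * B) $ n)"
    unfolding fps_mult_nth sum_distrib_left sum_distrib_right
    by (subst sum.swap) (simp add: mult_ac)
  finally show ?thesis .
qed

text \<open>
  Let f = x / \<phi> and let h be the m-th power of its inverse. Then h o f = x^m, and differentiating
  and multiplying by \<phi>^k isolates the k-th coefficient of h through the residues above.
\<close>
lemma fps_lagrange_inversion:
  fixes \<phi> :: "'a::field_char_0 fps"
  assumes \<phi>: "\<phi> $ 0 \<noteq> 0" and m: "m \<le> k" "k > 0"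
  shows "of_nat k * (fps_inv (fps_X * inverse \<phi>) ^ m) $ k = of_nat m * (\<phi> ^ k) $ (k - m)"
proof (cases "m = 0")
  case False
  define f where "f = fps_X * inverse \<phi>"
  define h where "h = fps_inv f ^ m"
  have f\<phi>: "f * \<phi> = fps_X" by (simp add: f_def \<phi> inverse_mult_eq_1 mult.assoc)
  have f0: "f $ 0 = 0" "f $ 1 \<noteq> 0" by (simp_all add: f_def \<phi>)
  have "h oo f = fps_X ^ m"
    using f0 by (simp add: h_def fps_inv flip: fps_compose_power)
  then have "fps_deriv (h oo f) = of_nat m * fps_X ^ (m - 1)"
    using fps_deriv_power'[of fps_X m] by simp
  then have "of_nat m * (fps_X ^ (m - 1) * \<phi> ^ k) = (fps_deriv h oo f) * (fps_deriv f * \<phi> ^ k)"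
    by (simp add: fps_compose_deriv[OF f0(1)] mult_ac)
  then have "(of_nat m * (fps_X ^ (m - 1) * \<phi> ^ k)) $ (k - 1) =
      (\<Sum>i\<le>k-1. fps_deriv h $ i * (f ^ i * (fps_deriv f * \<phi> ^ k)) $ (k - 1))"
    by (simp only: fps_compose_mult_nth_truncate[OF f0(1) order_refl])
  also have "\<dots> = (\<Sum>i\<le>k-1. fps_deriv h $ i * (if Suc i = k then 1 else 0))"
    using m fps_residue_inverse_function[OF f\<phi> \<phi>]
    by (intro sum.cong refl) (auto simp: mult_ac)
  also have "\<dots> = (\<Sum>i\<le>k-1. if i = k - 1 then fps_deriv h $ i else 0)"
    using m by (intro sum.cong) auto
  also have "\<dots> = of_nat k * h $ k" using m by simp
  finally have "of_nat k * h $ k = (of_nat m * (fps_X ^ (m - 1) * \<phi> ^ k)) $ (k - 1)" ..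
  also have "\<dots> = of_nat m * (\<phi> ^ k) $ (k - m)"
    using m False by (simp add: fps_X_power_mult_nth flip: fps_of_nat)
  finally show ?thesis by (simp add: h_def f_def)
qed (use m in auto)


section \<open>The limit: an inviscid Burgers hierarchy\<close>

text \<open>
  Apart from sign and scaling these are the moments to be obtained. As functions of t they are
  the coefficients of the solution \<psi> of \<psi>_t = - x (\<psi>^2 / 2)_x with initial value x / (1 + x).
\<close>
definition burgers_coeff :: "nat \<Rightarrow> complex \<Rightarrow> complex" where
  "burgers_coeff k t = (-1) ^ Suc k / of_nat k * (((1 + fps_X) ^ k * fps_exp (t * of_nat k)) $ (k - 1))"

lemma fps_one_plus_X_exp_nth:
  "((1 + fps_X) ^ k * fps_exp c) $ m = (\<Sum>j=0..m. of_nat (k choose (m - j)) * c ^ j / fact j)"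
  for c :: "'a::field_char_0"
proof -
  have "((1 + fps_X) ^ k :: 'a fps) $ i = of_nat (k choose i)" for i
    by (simp add: fps_binomial_power[symmetric] fps_binomial_of_nat[symmetric] binomial_gbinomial)
  then show ?thesis
    by (subst mult.commute) (simp add: fps_mult_nth mult_ac)
qed

lemma burgers_coeff_0 [simp]: "burgers_coeff 0 t = 0" by (simp add: burgers_coeff_def)

lemma burgers_coeff_at_0: "k > 0 \<Longrightarrow> burgers_coeff k 0 = (-1) ^ Suc k"
  unfolding burgers_coeff_def fps_one_plus_X_exp_nth
  by (cases k) (simp_all add: sum.atLeast_Suc_atMost power_0_left del: of_nat_Suc)

text \<open>
  By Lagrange inversion for \<phi> = (1 + x) e^(t x), the generating function of these coefficients is,
  up to alternating signs, the inverse g of x / \<phi>. The convolution on the right is thus a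
  coefficient of g^2, which the same inversion formula expresses through \<phi>^k; and this is
  what differentiating the k-th coefficient in t produces.
\<close>
lemma burgers_coeff_has_derivative:
  assumes "k > 0"
  shows "(burgers_coeff k has_field_derivative
           - of_nat k / 2 * (\<Sum>i\<le>k. burgers_coeff i t * burgers_coeff (k - i) t)) (at t within T)"
proof -
  define \<phi> where "\<phi> = (1 + fps_X) * fps_exp t"
  define g where "g = fps_inv (fps_X * inverse \<phi>)"
  have \<phi>0: "\<phi> $ 0 \<noteq> 0" by (simp add: \<phi>_def)
  have \<phi>k: "\<phi> ^ k = (1 + fps_X) ^ k * fps_exp (t * of_nat k)" for k
    by (simp add: \<phi>_def power_mult_distrib fps_exp_power_mult mult.commute)
  have g1: "burgers_coeff i t = (-1) ^ Suc i * g $ i" for i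
  proof (cases "i = 0")
    case True then show ?thesis by (simp add: g_def fps_inv_def)
  next
    case False
    then show ?thesis using fps_lagrange_inversion[OF \<phi>0, of 1 i]
      by (simp add: burgers_coeff_def g_def \<phi>k field_simps)
  qed
  have "burgers_coeff i t * burgers_coeff (k - i) t = (-1) ^ k * (g $ i * g $ (k - i))" if "i \<le> k" for i
  proof -
    have "(-1) ^ k = ((-1) ^ i * (-1) ^ (k - i) :: complex)"
      using that by (simp flip: power_add)
    then show ?thesis by (simp add: g1)
  qed
  then have "(\<Sum>i\<le>k. burgers_coeff i t * burgers_coeff (k - i) t) = (-1) ^ k * (g\<^sup>2) $ k"
    unfolding power2_eq_square fps_mult_nth sum_distrib_left atMost_atLeast0
    by (intro sum.cong refl) auto
  also have "of_nat k / 2 * \<dots> = (-1) ^ k * (if k < 2 then 0 else (\<phi> ^ k) $ (k - 2))"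
  proof (cases "k < 2")
    case True
    then have "k = 1" using assms by simp
    then show ?thesis by (simp add: power2_eq_square fps_mult_nth g_def fps_inv_def)
  next
    case False
    then show ?thesis using fps_lagrange_inversion[OF \<phi>0, of 2 k] by (simp add: g_def)
  qed
  finally have rhs: "- of_nat k / 2 * (\<Sum>i\<le>k. burgers_coeff i t * burgers_coeff (k - i) t)
     = (-1) ^ Suc k * (if k < 2 then 0 else (\<phi> ^ k) $ (k - 2))" by simp
  let ?c = "\<lambda>t::complex. \<Sum>j=0..k-1. of_nat (k choose (k - 1 - j)) * (t * of_nat k) ^ j / fact j"
  have *: "(?c has_field_derivative (of_nat k * (if k < 2 then 0 else (\<phi> ^ k) $ (k - 2)))) (at t within T)"
  proof (cases "k < 2")
    case True
    then have "k = 1" using assms by simp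
    then show ?thesis by simp
  next
    case False
    then obtain l where l: "k = Suc (Suc l)" by (metis add_2_eq_Suc le_Suc_ex not_less)
    have "?c = (\<lambda>t. of_nat (k choose (k - 1)) + (\<Sum>j=0..l. of_nat (k choose (l - j)) * (t * of_nat k) ^ Suc j / fact (Suc j)))"
      by (rule ext) (simp add: l sum.atLeast0_atMost_Suc_shift
          del: sum.cl_ivl_Suc fact_Suc power_Suc binomial_Suc_Suc of_nat_Suc)
    moreover have "(\<dots> has_field_derivative (\<Sum>j=0..l. of_nat (k choose (l - j)) *
        (of_nat k * (of_nat (Suc j) * (t * of_nat k) ^ j)) / fact (Suc j))) (at t within T)"
      by (auto intro!: derivative_eq_intros sum.cong simp: mult_ac simp del: power_Suc fact_Suc)
    moreover have "(\<Sum>j=0..l. of_nat (k choose (l - j)) *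
        (of_nat k * (of_nat (Suc j) * (t * of_nat k) ^ j)) / fact (Suc j)) = of_nat k * (\<phi> ^ k) $ (k - 2)"
      unfolding \<phi>k fps_one_plus_X_exp_nth sum_distrib_left
      by (intro sum.cong) (auto simp: l divide_simps simp del: of_nat_Suc)
    ultimately show ?thesis using False by simp
  qed
  have "burgers_coeff k = (\<lambda>t. (-1) ^ Suc k / of_nat k * ?c t)"
    by (simp add: burgers_coeff_def fun_eq_iff fps_one_plus_X_exp_nth)
  then show ?thesis unfolding rhs using DERIV_cmult[OF *, of "(-1) ^ Suc k / of_nat k"] assms
    by simp
qed

section \<open>The logarithmic derivative of the heat flow\<close>

text \<open>
  The polynomial (1 + x)^n evolved for time t under F_t = - (x d/dx)^2 F / (2 n). The time is
  complex so that the dependence on t can be treated by complex differentiation.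
\<close>
definition heat_fps :: "nat \<Rightarrow> complex \<Rightarrow> complex fps" where
  "heat_fps n t = Abs_fps (\<lambda>j. of_nat (n choose j) * exp (- t * of_nat j ^ 2 / (2 * of_nat n)))"

definition fps_theta :: "'a::comm_ring_1 fps \<Rightarrow> 'a fps" where
  "fps_theta A = fps_X * fps_deriv A"

definition log_deriv_fps :: "nat \<Rightarrow> complex \<Rightarrow> complex fps" where
  "log_deriv_fps n t = fps_const (1 / of_nat n) * fps_theta (heat_fps n t) * inverse (heat_fps n t)"

lemma fps_theta_nth [simp]: "fps_nth (fps_theta A) k = of_nat k * fps_nth A k"
  by (cases k) (auto simp: fps_theta_def)

lemma fps_theta_add: "fps_theta (A + B) = fps_theta A + fps_theta B"
  by (simp add: fps_theta_def algebra_simps)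
lemma fps_theta_mult: "fps_theta (A * B) = fps_theta A * B + A * fps_theta B"
  by (simp add: fps_theta_def algebra_simps)
lemma fps_theta_const_mult: "fps_theta (fps_const c * A) = fps_const c * fps_theta A"
  by (simp add: fps_theta_def algebra_simps)

lemma log_deriv_fps_eq:
  assumes "n > 0"
  shows "fps_theta (heat_fps n t) = of_nat n * (log_deriv_fps n t * heat_fps n t)"
proof -
  have "fps_nth (heat_fps n t) 0 \<noteq> 0" by (simp add: heat_fps_def)
  then have "log_deriv_fps n t * heat_fps n t = fps_const (1 / of_nat n) * fps_theta (heat_fps n t)"
    by (simp add: log_deriv_fps_def mult.assoc inverse_mult_eq_1)
  moreover have "of_nat n * fps_const (1 / of_nat n) = (1 :: complex fps)"
    using assms by (simp flip: fps_of_nat)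
  ultimately show ?thesis by (simp flip: mult.assoc)
qed

lemma log_deriv_fps_unique:
  assumes "n > 0" "fps_theta (heat_fps n t) = of_nat n * (A * heat_fps n t)"
  shows "A = log_deriv_fps n t"
proof -
  have "fps_nth (heat_fps n t) 0 \<noteq> 0" by (simp add: heat_fps_def)
  then have "heat_fps n t \<noteq> 0" by auto
  then show ?thesis using log_deriv_fps_eq[OF assms(1), of t] assms
    by auto
qed

text \<open>
  Differentiation in the parameter is formal in the variable of the series: it does not involve
  convergence.
\<close>
definition fps_has_deriv :: "(complex \<Rightarrow> complex fps) \<Rightarrow> complex fps \<Rightarrow> complex \<Rightarrow> bool" where
  "fps_has_deriv A A' t \<longleftrightarrow> (\<forall>k. ((\<lambda>t. fps_nth (A t) k) has_field_derivative fps_nth A' k) (at t))"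

lemma fps_has_deriv_mult:
  assumes "fps_has_deriv A A' t" "fps_has_deriv B B' t"
  shows "fps_has_deriv (\<lambda>t. A t * B t) (A' * B t + A t * B') t"
  unfolding fps_has_deriv_def
proof
  fix k
  have "((\<lambda>t. \<Sum>i=0..k. fps_nth (A t) i * fps_nth (B t) (k - i)) has_field_derivative
      (\<Sum>i=0..k. fps_nth A' i * fps_nth (B t) (k - i) + fps_nth B' (k - i) * fps_nth (A t) i)) (at t)"
    using assms by (intro DERIV_sum DERIV_mult) (auto simp: fps_has_deriv_def)
  then show "((\<lambda>t. fps_nth (A t * B t) k) has_field_derivative fps_nth (A' * B t + A t * B') k) (at t)"
    by (simp add: fps_mult_nth sum.distrib mult.commute[of "fps_nth B' _"])
qed

lemma fps_has_deriv_cmult: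
  "fps_has_deriv A A' t \<Longrightarrow> fps_has_deriv (\<lambda>t. fps_const c * A t) (fps_const c * A') t"
  by (auto simp: fps_has_deriv_def intro!: DERIV_cmult)

lemma fps_has_deriv_theta:
  "fps_has_deriv A A' t \<Longrightarrow> fps_has_deriv (\<lambda>t. fps_theta (A t)) (fps_theta A') t"
  by (auto simp: fps_has_deriv_def intro!: DERIV_cmult)

lemma fps_has_deriv_unique:
  "fps_has_deriv A A' t \<Longrightarrow> fps_has_deriv A A'' t \<Longrightarrow> A' = A''"
  by (auto simp: fps_has_deriv_def fps_eq_iff intro: DERIV_unique)

text \<open>
  The coefficients of the inverse are given by a recursion in the coefficients of A, which
  preserves differentiability. The value of the derivative follows later from an equation that it
  has to satisfy, so existence suffices here.
\<close>
lemma fps_has_deriv_inverse_exists: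
  assumes A: "fps_has_deriv A A' t" and nz: "\<And>t. fps_nth (A t) 0 \<noteq> 0"
  shows "\<exists>B'. fps_has_deriv (\<lambda>t. inverse (A t)) B' t"
proof -
  have "(\<lambda>t. fps_nth (inverse (A t)) k) field_differentiable (at t)" for k
  proof (induction k rule: less_induct)
    case (less k)
    have A': "(\<lambda>t. fps_nth (A t) i) field_differentiable (at t)" for i
      using A by (auto simp: fps_has_deriv_def field_differentiable_def)
    show ?case
    proof (cases k)
      case 0
      then show ?thesis using A' nz by (auto intro!: field_differentiable_inverse)
    next
      case (Suc l)
      have "fps_nth (inverse (A t)) k =
        - inverse (fps_nth (A t) 0) * (\<Sum>i=1..k. fps_nth (A t) i * fps_nth (inverse (A t)) (k - i))" for t
      proof -
        have "0 = fps_nth (A t * inverse (A t)) k"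
          using nz[of t] by (simp add: inverse_mult_eq_1' Suc)
        also have "\<dots> = fps_nth (A t) 0 * fps_nth (inverse (A t)) k +
          (\<Sum>i=1..k. fps_nth (A t) i * fps_nth (inverse (A t)) (k - i))"
          by (simp add: fps_mult_nth sum.atLeast_Suc_atMost)
        finally show ?thesis using nz[of t] by (simp add: field_simps eq_neg_iff_add_eq_0)
      qed
      moreover have "(\<lambda>t. - inverse (fps_nth (A t) 0) *
          (\<Sum>i=1..k. fps_nth (A t) i * fps_nth (inverse (A t)) (k - i))) field_differentiable (at t)"
        using A' nz less by (intro field_differentiable_mult field_differentiable_sum
            field_differentiable_minus field_differentiable_inverse) auto
      ultimately show ?thesis by simp
    qed
  qed
  then have "fps_has_deriv (\<lambda>t. inverse (A t)) (Abs_fps (\<lambda>k. deriv (\<lambda>t. fps_nth (inverse (A t)) k) t)) t"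
    by (auto simp: fps_has_deriv_def field_differentiable_derivI)
  then show ?thesis by blast
qed

lemma heat_fps_has_deriv:
  assumes "n > 0"
  shows "fps_has_deriv (heat_fps n) (fps_const (- 1 / (2 * of_nat n)) * fps_theta (fps_theta (heat_fps n t))) t"
  unfolding fps_has_deriv_def heat_fps_def using assms
  by (auto intro!: derivative_eq_intros simp: power2_eq_square field_simps)

text \<open>
  The Cole-Hopf transformation: the logarithmic derivative of a solution of the heat equation
  satisfies the viscous Burgers equation, here with viscosity 1 / (2n).
\<close>
lemma log_deriv_fps_has_deriv:
  assumes n: "n > 0"
  shows "fps_has_deriv (log_deriv_fps n)
    (- fps_const (1 / (2 * of_nat n)) * fps_theta (fps_theta (log_deriv_fps n t))
     - fps_const (1/2) * fps_theta (log_deriv_fps n t ^ 2)) t"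
proof -
  define F where "F = heat_fps n t"
  define P where "P = log_deriv_fps n t"
  define N where "N = (of_nat n :: complex fps)"
  define M where "M = (fps_const (1 / of_nat n) :: complex fps)"
  define H where "H = (fps_const (1 / 2) :: complex fps)"
  have NM: "N * M = 1" "2 * H = 1" using n
    by (simp_all add: N_def M_def H_def flip: fps_of_nat)
  have F0: "F \<noteq> 0"
  proof -
    have "fps_nth F 0 \<noteq> 0" by (simp add: F_def heat_fps_def)
    then show ?thesis by auto
  qed
  have "\<exists>B'. fps_has_deriv (\<lambda>t. inverse (heat_fps n t)) B' t"
    by (rule fps_has_deriv_inverse_exists[OF heat_fps_has_deriv[OF n]]) (simp add: heat_fps_def)
  then obtain P' where P': "fps_has_deriv (log_deriv_fps n) P' t"
    using fps_has_deriv_mult[OF fps_has_deriv_cmult[OF fps_has_deriv_theta[OF heat_fps_has_deriv[OF n]]]]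
    unfolding log_deriv_fps_def[abs_def] by blast
  have th: "fps_theta F = N * (P * F)"
    using log_deriv_fps_eq[OF n] by (simp add: F_def P_def N_def)
  define F' where "F' = fps_const (- 1 / (2 * of_nat n)) * fps_theta (fps_theta F)"
  have F'_eq: "F' = - H * M * fps_theta (fps_theta F)"
    by (simp add: F'_def H_def M_def)
  have thN: "fps_theta (N * A) = N * fps_theta A" for A
    unfolding N_def fps_of_nat[symmetric] by (rule fps_theta_const_mult)
  have thN0: "fps_theta N = 0" "fps_theta H = 0" by (simp_all add: N_def H_def fps_theta_def)
  have thH: "fps_theta (H * A) = H * fps_theta A" for A
    unfolding H_def by (rule fps_theta_const_mult)
  have thU: "fps_theta (- A) = - fps_theta A" for A :: "complex fps"
    by (simp add: fps_theta_def)
  have "fps_has_deriv (\<lambda>t. of_nat n * (log_deriv_fps n t * heat_fps n t)) (N * (P' * F + P * F')) t"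
    unfolding N_def F_def P_def F'_def fps_of_nat[symmetric]
    by (intro fps_has_deriv_cmult fps_has_deriv_mult P' heat_fps_has_deriv n)
  moreover have "fps_has_deriv (\<lambda>t. fps_theta (heat_fps n t)) (fps_theta F') t"
    unfolding F'_def F_def by (intro fps_has_deriv_theta heat_fps_has_deriv n)
  ultimately have eq: "N * (P' * F + P * F') = fps_theta F'"
    using log_deriv_fps_eq[OF n] by (auto dest: fps_has_deriv_unique)
  \<comment> \<open>The heat equation in terms of P: the second \<theta>-derivative of F is n (\<theta> P + n P^2) F.\<close>
  have F'2: "F' = - (H * ((fps_theta P + N * P ^ 2) * F))"
  proof -
    have "fps_theta (fps_theta F) = N * ((fps_theta P + N * P ^ 2) * F)"
      unfolding th thN fps_theta_mult by (simp add: thN0 th power2_eq_square algebra_simps)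
    then have "F' = - H * (N * M) * ((fps_theta P + N * P ^ 2) * F)" unfolding F'_eq by (simp add: mult_ac)
    then show ?thesis by (simp add: NM)
  qed
  have "fps_theta F' = - H * ((fps_theta (fps_theta P) + N * fps_theta (P ^ 2)) * F
          + (fps_theta P + N * P ^ 2) * (N * (P * F)))"
    unfolding F'2 by (simp add: thN0 thU thH fps_theta_mult fps_theta_add thN0 th[symmetric])
  with eq have "N * P' * F = - H * (fps_theta (fps_theta P) + N * fps_theta (P ^ 2)) * F"
    unfolding F'2 by (simp add: algebra_simps)
  then have "N * P' = - H * (fps_theta (fps_theta P) + N * fps_theta (P ^ 2))"
    using F0 by (metis mult_right_cancel)
  then have "M * (N * P') = M * (- H * (fps_theta (fps_theta P) + N * fps_theta (P ^ 2)))"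
    by simp
  moreover have "M * (N * P') = P'" using NM by (metis mult.assoc mult.commute mult_1)
  moreover have "M * (- H * (fps_theta (fps_theta P) + N * fps_theta (P ^ 2))) =
     - (M * H) * fps_theta (fps_theta P) - (N * M) * H * fps_theta (P ^ 2)"
    by (simp add: algebra_simps)
  ultimately have "P' = - (M * H) * fps_theta (fps_theta P) - H * fps_theta (P ^ 2)"
    by (simp add: NM)
  moreover have "M * H = fps_const (1 / (2 * of_nat n))" by (simp add: M_def H_def)
  ultimately have P'_eq: "P' = - fps_const (1 / (2 * of_nat n)) * fps_theta (fps_theta (log_deriv_fps n t))
     - fps_const (1/2) * fps_theta (log_deriv_fps n t ^ 2)" by (simp only: P_def H_def)
  show ?thesis using P' unfolding P'_eq .
qed

section \<open>Convergence of the coefficients\<close>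

lemma uniform_limit_exp_over_n:
  "uniform_limit (cball 0 R) (\<lambda>n t. exp (c * t / of_nat n)) (\<lambda>_. 1 :: complex) sequentially"
proof (cases "c = 0")
  case False
  show ?thesis
  proof (rule uniform_limitI)
    fix e :: real assume e: "e > 0"
    obtain d where d: "d > 0" "\<And>z::complex. norm z < d \<Longrightarrow> dist (exp z) 1 < e"
    proof -
      have "isCont (exp :: complex \<Rightarrow> complex) 0" by (intro continuous_intros)
      then show ?thesis using that e unfolding continuous_at_eps_delta
        by (metis dist_0_norm dist_commute exp_zero)
    qed
    have "(\<lambda>n. norm c * R / real n) \<longlonglongrightarrow> 0" by real_asymp
    then have "eventually (\<lambda>n. norm c * R / real n < d) sequentially"
      by (rule order_tendstoD(2)) (use d in auto)
    then show "\<forall>\<^sub>F n in sequentially. \<forall>t\<in>cball 0 R. dist (exp (c * t / of_nat n)) 1 < e"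
    proof eventually_elim
      case (elim n)
      have "norm (c * t / of_nat n) < d" if "t \<in> cball 0 R" for t
      proof -
        have "norm (c * t / of_nat n) \<le> norm c * R / real n"
          using that by (auto simp: norm_mult norm_divide intro!: divide_right_mono mult_left_mono)
        then show ?thesis using elim by linarith
      qed
      then show ?case using d(2) by blast
    qed
  qed
qed (simp add: uniform_limit_const)

lemma uniform_limit_sum:
  fixes f :: "'i \<Rightarrow> 'n \<Rightarrow> 'a \<Rightarrow> 'b::real_normed_vector"
  assumes "\<And>i. i \<in> I \<Longrightarrow> uniform_limit S (f i) (l i) F"
  shows "uniform_limit S (\<lambda>n x. \<Sum>i\<in>I. f i n x) (\<lambda>x. \<Sum>i\<in>I. l i x) F"
  using assms by (induction I rule: infinite_finite_induct) (auto intro!: uniform_limit_intros)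

text \<open>
  At time 0 the flow starts from (1 + x)^n, whose normalised logarithmic derivative does not
  depend on n. This is the common initial value of the viscous and the inviscid system.
\<close>
lemma log_deriv_fps_at_0:
  assumes "n > 0"
  shows "log_deriv_fps n 0 = fps_X * inverse (1 + fps_X)"
proof -
  have "heat_fps n 0 = (1 + fps_X) ^ n"
    by (rule fps_ext) (simp add: heat_fps_def flip: fps_binomial_of_nat binomial_gbinomial)
  moreover have "fps_theta ((1 + fps_X) ^ n :: complex fps) =
      of_nat n * (fps_X * inverse (1 + fps_X) * (1 + fps_X) ^ n)"
  proof -
    have "(1 + fps_X) ^ n = (1 + fps_X) * (1 + fps_X :: complex fps) ^ (n - 1)"
      using assms by (cases n) auto
    moreover have "inverse (1 + fps_X) * (1 + fps_X :: complex fps) = 1"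
      by (rule inverse_mult_eq_1) simp
    ultimately have "inverse (1 + fps_X) * (1 + fps_X) ^ n = (1 + fps_X :: complex fps) ^ (n - 1)"
      by (metis mult.assoc mult_1)
    then show ?thesis
      by (simp add: fps_theta_def fps_deriv_power' mult_ac)
  qed
  ultimately show ?thesis using log_deriv_fps_unique[OF assms] by metis
qed

lemma log_deriv_fps_0 [simp]: "fps_nth (log_deriv_fps n t) 0 = 0"
  by (simp add: log_deriv_fps_def)

text \<open>
  The k-th coefficient b of the viscous solution satisfies b' = - k^2 b / (2n) - (k/2) Q, where Q
  only involves coefficients of smaller index. The integrating factor E = exp (k^2 t / (2n)) removes
  the linear term, so the derivative of E b differs from that of the inviscid coefficient by
  a quantity that tends to 0 uniformly, by induction. As the initial values agree, the
  mean value inequality gives the claim.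
\<close>
lemma log_deriv_coeff_uniform_limit:
  "uniform_limit (cball 0 R) (\<lambda>n t. fps_nth (log_deriv_fps n t) k) (burgers_coeff k) sequentially"
proof (induction k rule: less_induct)
  case (less k)
  show ?case
  proof (cases "k = 0")
    case True
    then show ?thesis by (simp add: burgers_coeff_def[abs_def] uniform_limit_const)
  next
    case False
    define S where "S = cball (0::complex) R"
    define E where "E n t = exp (of_nat (k\<^sup>2) / 2 * t / of_nat n :: complex)" for n t
    define b where "b n i t = fps_nth (log_deriv_fps n t) i" for n i t
    define Q where "Q n t = (\<Sum>i=1..<k. b n i t * b n (k - i) t)" for n t
    define L where "L t = (\<Sum>i=1..<k. burgers_coeff i t * burgers_coeff (k - i) t)" for t
    have lim_cont: "continuous_on S (burgers_coeff i)" for i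
    proof (cases "i = 0")
      case False
      then show ?thesis by (intro DERIV_continuous_on[OF burgers_coeff_has_derivative]) auto
    qed (simp add: burgers_coeff_def[abs_def])
    have bdd: "bounded (f ` S)" if "continuous_on S f" for f :: "complex \<Rightarrow> complex"
      using that unfolding S_def by (intro compact_imp_bounded compact_continuous_image) auto
    note lim_bounded = bdd[OF lim_cont]
    have IH: "uniform_limit S (\<lambda>n t. b n i t) (burgers_coeff i) sequentially" if "i < k" for i
      using less[OF that] by (simp add: S_def b_def)
    have Q_lim: "uniform_limit S Q L sequentially"
      unfolding Q_def L_def by (intro uniform_limit_sum uniform_lim_mult IH lim_bounded) auto
    have L_bounded: "bounded (L ` S)"
      unfolding L_def by (intro bdd continuous_intros lim_cont)
    have E_lim: "uniform_limit S E (\<lambda>_. 1) sequentially"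
      unfolding S_def E_def by (rule uniform_limit_exp_over_n)
    have EQ_lim: "uniform_limit S (\<lambda>n t. E n t * Q n t) (\<lambda>t. 1 * L t) sequentially"
      by (intro uniform_lim_mult E_lim Q_lim L_bounded) (auto simp: image_constant_conv)
    define D where "D n t = E n t * b n k t - burgers_coeff k t" for n t
    have D_deriv: "(D n has_field_derivative - of_nat k / 2 * (E n t * Q n t - L t)) (at t within S)"
      if "n > 0" for n t
    proof -
      \<comment> \<open>Coefficients of index 0 vanish, so the convolutions do not contain the k-th coefficient itself.\<close>
      have ends: "(\<Sum>i\<le>k. f i) = (\<Sum>i=1..<k. f i)" if "f 0 = 0" "f k = 0" for f :: "nat \<Rightarrow> complex"
      proof (rule sum.mono_neutral_right)
        show "\<forall>i\<in>{..k} - {1..<k}. f i = 0"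
        proof
          fix i assume "i \<in> {..k} - {1..<k}"
          then have "i = 0 \<or> i = k" by auto
          then show "f i = 0" using that by auto
        qed
      qed auto
      have "(b n k has_field_derivative
          - of_nat (k\<^sup>2) / (2 * of_nat n) * b n k t - of_nat k / 2 * Q n t) (at t)"
      proof -
        have "fps_nth ((log_deriv_fps n t)\<^sup>2) k = Q n t"
          unfolding power2_eq_square fps_mult_nth Q_def b_def atMost_atLeast0[symmetric]
          by (rule ends) auto
        then show ?thesis
          using log_deriv_fps_has_deriv[OF that, of t, unfolded fps_has_deriv_def, rule_format, of k]
          by (simp add: b_def[abs_def] power2_eq_square
             numeral_fps_const[symmetric] algebra_simps)
      qed
      moreover have "(\<Sum>i\<le>k. burgers_coeff i t * burgers_coeff (k - i) t) = L t"
        unfolding L_def by (rule ends) auto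
      then have "(burgers_coeff k has_field_derivative - of_nat k / 2 * L t) (at t)"
        using burgers_coeff_has_derivative[of k t] False by simp
      moreover have "(E n has_field_derivative E n t * (of_nat (k\<^sup>2) / (2 * of_nat n))) (at t)"
        using that unfolding E_def by (auto intro!: derivative_eq_intros)
      ultimately have "(D n has_field_derivative
         (E n t * (of_nat (k\<^sup>2) / (2 * of_nat n)) * b n k t +
         (- of_nat (k\<^sup>2) / (2 * of_nat n) * b n k t - of_nat k / 2 * Q n t) * E n t
         - (- of_nat k / 2 * L t))) (at t)"
        unfolding D_def by (intro DERIV_diff DERIV_mult)
      also have "(E n t * (of_nat (k\<^sup>2) / (2 * of_nat n)) * b n k t +
         (- of_nat (k\<^sup>2) / (2 * of_nat n) * b n k t - of_nat k / 2 * Q n t) * E n t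
         - (- of_nat k / 2 * L t)) = - of_nat k / 2 * (E n t * Q n t - L t)"
        by (simp add: algebra_simps)
      finally show ?thesis by (rule has_field_derivative_at_within)
    qed
    have D_lim: "uniform_limit S D (\<lambda>_. 0) sequentially"
    proof (rule uniform_limitI)
      fix e :: real assume e: "e > 0"
      \<comment> \<open>The mean value inequality on a ball of radius R loses a factor k/2 times R; adding 1 avoids a division by 0.\<close>
      define B where "B = e / (real k * (\<bar>R\<bar> + 1))"
      have B: "B > 0" using e False by (simp add: B_def)
      have "eventually (\<lambda>n. \<forall>t\<in>S. dist (E n t * Q n t) (1 * L t) < B) sequentially"
        using uniform_limitD[OF EQ_lim B] .
      then show "\<forall>\<^sub>F n in sequentially. \<forall>t\<in>S. dist (D n t) 0 < e"
        using eventually_gt_at_top[of 0]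
      proof eventually_elim
        case (elim n)
        show ?case
        proof
          fix t assume t: "t \<in> S"
          have D0: "D n 0 = 0"
          proof -
            have "fps_nth (log_deriv_fps n 0) k = (-1) ^ Suc k"
              using elim False by (cases k) (simp_all add: log_deriv_fps_at_0 fps_inverse_fps_X_plus1)
            then show ?thesis using False by (simp add: D_def b_def E_def burgers_coeff_at_0)
          qed
          have "norm (D n t - D n 0) \<le> real k / 2 * B * norm (t - 0)"
          proof (rule field_differentiable_bound[of S])
            show "convex S" by (simp add: S_def)
            show "t \<in> S" "0 \<in> S" using t by (auto simp: S_def intro: order_trans[OF norm_ge_zero])
            show "(D n has_field_derivative - of_nat k / 2 * (E n t * Q n t - L t)) (at t within S)" for t
              using D_deriv elim by auto
            fix z assume "z \<in> S"
            then have "norm (E n z * Q n z - L z) \<le> B" using elim by (auto simp: dist_norm)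
            then show "norm (- of_nat k / 2 * (E n z * Q n z - L z)) \<le> real k / 2 * B"
              by (simp add: norm_mult norm_divide mult_left_mono)
          qed
          also have "\<dots> \<le> real k / 2 * B * (\<bar>R\<bar> + 1)"
            using t B by (intro mult_left_mono) (auto simp: S_def)
          also have "\<dots> = e / 2" using False by (simp add: B_def divide_simps)
          also have "\<dots> < e" using e by simp
          finally show "dist (D n t) 0 < e" by (simp add: D0)
        qed
      qed
    qed
    have "uniform_limit S (\<lambda>n t. exp (- (of_nat (k\<^sup>2) / 2) * t / of_nat n) * (D n t + burgers_coeff k t))
       (\<lambda>t. 1 * (0 + burgers_coeff k t)) sequentially"
      unfolding S_def
      by (intro uniform_lim_mult uniform_limit_exp_over_n uniform_limit_add
            D_lim[unfolded S_def] uniform_limit_const)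
         (use lim_bounded in \<open>auto simp: image_constant_conv S_def\<close>)
    also have "(\<lambda>n t. exp (- (of_nat (k\<^sup>2) / 2) * t / of_nat n) * (D n t + burgers_coeff k t)) = (\<lambda>n t. b n k t)"
      by (simp add: D_def E_def fun_eq_iff mult.assoc[symmetric] flip: exp_add)
    finally show ?thesis by (simp add: b_def S_def)
  qed
qed

lemma log_deriv_coeff_tendsto: "(\<lambda>n. fps_nth (log_deriv_fps n t) k) \<longlonglongrightarrow> burgers_coeff k t"
  by (rule tendsto_uniform_limitI[OF log_deriv_coeff_uniform_limit[where R = "norm t" and k = k]]) simp

section \<open>Location of the zeros\<close>

definition euler_shift :: "complex \<Rightarrow> complex poly \<Rightarrow> complex poly" where
  "euler_shift c p = [:0, 1:] * pderiv p + smult c p"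

lemma coeff_euler_shift: "coeff (euler_shift c p) j = (of_nat j + c) * coeff p j"
  by (cases j) (auto simp: euler_shift_def coeff_pderiv algebra_simps)

lemma poly_pderiv_prod_linear:
  fixes A :: "complex multiset"
  assumes "\<And>a. a \<in># A \<Longrightarrow> x \<noteq> a"
  shows "poly (pderiv (\<Prod>a\<in>#A. [:- a, 1:])) x =
    poly (\<Prod>a\<in>#A. [:- a, 1:]) x * (\<Sum>a\<in>#A. 1 / (x - a))"
  using assms
proof (induction A)
  case (add a A)
  then have "x \<noteq> a" by auto
  define Q where "Q = (\<Prod>a\<in>#A. [:- a, 1:])"
  have "poly (pderiv Q) x = poly Q x * (\<Sum>a\<in>#A. 1 / (x - a))"
    using add unfolding Q_def by auto
  moreover have "poly (pderiv ([:- a, 1:] * Q)) x = (x - a) * poly (pderiv Q) x + poly Q x"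
    by (simp only: pderiv_mult) (simp add: pderiv_pCons algebra_simps)
  ultimately have "poly (pderiv ([:- a, 1:] * Q)) x =
      (x - a) * poly Q x * (1 / (x - a) + (\<Sum>a\<in>#A. 1 / (x - a)))"
    using \<open>x \<noteq> a\<close> by (simp add: distrib_left)
  moreover have "poly ([:- a, 1:] * Q) x = (x - a) * poly Q x" by (simp add: algebra_simps)
  ultimately show ?case by (simp only: Q_def image_mset_add_mset prod_mset.add_mset sum_mset.add_mset)
qed simp

text \<open>
  Expressing x p'(x) / p(x) as a sum over the zeros turns the question whether x is a zero of the
  new polynomial into an equation between x and the old zeros.
\<close>
lemma poly_euler_shift:
  fixes p :: "complex poly"
  assumes "p \<noteq> 0" "poly p x \<noteq> 0"
  shows "poly (euler_shift c p) x = poly p x * ((\<Sum>a\<in>#proots p. x / (x - a)) + c)"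
proof -
  let ?q = "\<Prod>a\<in>#proots p. [:- a, 1:]"
  have p: "smult (lead_coeff p) ?q = p" by (rule complex_poly_decompose_multiset)
  have "poly (pderiv p) x = lead_coeff p * poly (pderiv ?q) x"
    by (subst p[symmetric]) (simp only: pderiv_smult poly_smult)
  also have "poly (pderiv ?q) x = poly ?q x * (\<Sum>a\<in>#proots p. 1 / (x - a))"
    using assms by (intro poly_pderiv_prod_linear) auto
  also have "lead_coeff p * (poly ?q x * (\<Sum>a\<in>#proots p. 1 / (x - a))) =
    poly p x * (\<Sum>a\<in>#proots p. 1 / (x - a))"
    by (subst (4) p[symmetric]) simp
  finally show ?thesis
    by (simp add: euler_shift_def algebra_simps sum_mset_distrib_left)
qed

lemma sum_mset_pos:
  fixes f :: "'a \<Rightarrow> real"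
  assumes "A \<noteq> {#}" "\<And>a. a \<in># A \<Longrightarrow> f a > 0"
  shows "(\<Sum>a\<in>#A. f a) > 0"
  using assms
proof (induction A)
  case (add a A)
  then show ?case by (cases "A = {#}") (auto intro!: add_pos_pos)
qed simp

lemma Im_sum_mset: "Im (\<Sum>a\<in>#A. f a) = (\<Sum>a\<in>#A. Im (f a))"
  by (induction A) auto
lemma Re_sum_mset: "Re (\<Sum>a\<in>#A. f a) = (\<Sum>a\<in>#A. Re (f a))"
  by (induction A) auto

definition roots_in :: "complex set \<Rightarrow> complex poly \<Rightarrow> bool" where
  "roots_in S p \<longleftrightarrow> (\<forall>z. poly p z = 0 \<longrightarrow> z \<in> S)"

abbreviation pos_reals :: "complex set" where "pos_reals \<equiv> complex_of_real ` {0<..}"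

text \<open>
  For non-real x all summands of \<Sum> x / (x - a) have imaginary parts of the same strict sign, so the
  sum cannot be the real number -c. For x \<le> 0 each summand lies in [0, 1], so the sum lies in
  [0, degree p], which does not contain -c.
\<close>
lemma euler_shift_pos_roots:
  assumes p: "roots_in pos_reals p" and c: "c > 0 \<or> c < - real (degree p)"
  shows "roots_in pos_reals (euler_shift (of_real c) p)"
  unfolding roots_in_def
proof (intro allI impI)
  fix x assume x: "poly (euler_shift (of_real c) p) x = 0"
  have "0 \<notin> pos_reals" by auto
  then have p0: "p \<noteq> 0" using p by (auto simp: roots_in_def)
  show "x \<in> pos_reals"
  proof (rule ccontr)
    assume x': "x \<notin> pos_reals"
    then have px: "poly p x \<noteq> 0" using p by (auto simp: roots_in_def)
    then have sum: "(\<Sum>a\<in>#proots p. x / (x - a)) = - of_real c"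
      using poly_euler_shift[OF p0 px, of "of_real c"] x by (simp add: eq_neg_iff_add_eq_0)
    have roots: "\<exists>r>0. a = of_real r" if "a \<in># proots p" for a
      using that p p0 by (auto simp: roots_in_def)
    have ne: "proots p \<noteq> {#}" using sum c by auto
    show False
    proof (cases "Im x = 0")
      case False
      have "Im (\<Sum>a\<in>#proots p. x / (x - a)) = - Im x * (\<Sum>a\<in>#proots p. Re a / (cmod (x - a))\<^sup>2)"
        unfolding Im_sum_mset sum_mset_distrib_left
      proof (intro arg_cong[where f = sum_mset] image_mset_cong)
        fix a assume "a \<in># proots p"
        then obtain r where "a = of_real r" using roots by blast
        then have "Im a = 0" by simp
        then show "Im (x / (x - a)) = - Im x * (Re a / (cmod (x - a))\<^sup>2)"
          unfolding Im_divide cmod_power2 by (simp add: algebra_simps diff_divide_distrib)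
      qed
      moreover have "(\<Sum>a\<in>#proots p. Re a / (cmod (x - a))\<^sup>2) > 0"
      proof (rule sum_mset_pos[OF ne])
        fix a assume "a \<in># proots p"
        then obtain r where "r > 0" "a = of_real r" using roots by blast
        moreover have "x \<noteq> a" using False \<open>a = of_real r\<close> by auto
        ultimately show "Re a / (cmod (x - a))\<^sup>2 > 0" by simp
      qed
      ultimately show False using sum False by simp
    next
      case True
      define y where "y = Re x"
      have xy: "x = of_real y" using True by (simp add: y_def complex_eq_iff)
      have y: "y \<le> 0" using x' xy by (auto simp: image_iff not_less)
      define f where "f a = y / (y - Re a)" for a
      have "Re (\<Sum>a\<in>#proots p. x / (x - a)) = (\<Sum>a\<in>#proots p. f a)"
        unfolding Re_sum_mset
      proof (intro arg_cong[where f = sum_mset] image_mset_cong)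
        fix a assume "a \<in># proots p"
        then obtain r where a: "a = of_real r" using roots by blast
        have "x / (x - a) = of_real (f a)" by (simp add: a xy f_def)
        then show "Re (x / (x - a)) = f a" by simp
      qed
      with sum have fc: "(\<Sum>a\<in>#proots p. f a) = - c" by simp
      have f: "0 \<le> f a" "f a \<le> 1" if "a \<in># proots p" for a
        using roots[OF that] y by (auto simp: f_def divide_simps)
      have "(\<Sum>a\<in>#proots p. f a) \<ge> 0"
        using f sum_mset_mono[of "proots p" "\<lambda>_. 0" f] by simp
      moreover have "(\<Sum>a\<in>#proots p. f a) \<le> (\<Sum>a\<in>#proots p. 1)"
        using f by (intro sum_mset_mono) auto
      ultimately show False using fc c by (simp add: size_proots_complex)
    qed
  qed
qed

abbreviation unit_circle :: "complex set" where "unit_circle \<equiv> sphere 0 1"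

text \<open>
  For |a| = 1 the real part of x / (x - a) - 1/2 has the sign of |x| - 1. Summing over the zeros, the
  real part of \<Sum> x / (x - a) + c vanishes only for |x| = 1.
\<close>
lemma euler_shift_circle_roots:
  assumes p: "roots_in unit_circle p" and deg: "degree p > 0" and c: "Re c = - real (degree p) / 2"
  shows "roots_in unit_circle (euler_shift c p)"
  unfolding roots_in_def
proof (intro allI impI)
  fix x assume x: "poly (euler_shift c p) x = 0"
  have p0: "p \<noteq> 0" using deg by auto
  show "x \<in> unit_circle"
  proof (rule ccontr)
    assume x': "x \<notin> unit_circle"
    then have px: "poly p x \<noteq> 0" using p by (auto simp: roots_in_def)
    then have sum: "(\<Sum>a\<in>#proots p. x / (x - a)) + c = 0"
      using poly_euler_shift[OF p0 px, of c] x by simp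
    have "size (proots p) \<noteq> 0" using deg by (simp add: size_proots_complex)
    then have ne: "proots p \<noteq> {#}" by auto
    have re: "Re (x / (x - a)) = 1 / 2 + ((cmod x)\<^sup>2 - 1) / 2 * (1 / (cmod (x - a))\<^sup>2)"
      if "a \<in># proots p" for a
    proof -
      have "poly p a = 0" using that p0 by simp
      then have a: "cmod a = 1" "x \<noteq> a" using p px by (auto simp: roots_in_def)
      have a2: "(Re a)\<^sup>2 + (Im a)\<^sup>2 = 1" using a(1) by (metis cmod_power2 one_power2)
      have "(cmod (x - a))\<^sup>2 \<noteq> 0" using a by simp
      moreover have "2 * (Re x * (Re x - Re a) + Im x * (Im x - Im a)) = (cmod (x - a))\<^sup>2 + ((cmod x)\<^sup>2 - 1)"
        using a2 unfolding cmod_power2 by (simp add: power2_eq_square algebra_simps)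
      moreover have "Re (x / (x - a)) = (Re x * (Re x - Re a) + Im x * (Im x - Im a)) / (cmod (x - a))\<^sup>2"
        unfolding Re_divide cmod_power2 by simp
      ultimately show ?thesis by (simp add: field_simps)
    qed
    have "Re (\<Sum>a\<in>#proots p. x / (x - a)) =
       (\<Sum>a\<in>#proots p. 1 / 2 + ((cmod x)\<^sup>2 - 1) / 2 * (1 / (cmod (x - a))\<^sup>2))"
      unfolding Re_sum_mset using re by (intro arg_cong[where f = sum_mset] image_mset_cong) auto
    also have "\<dots> = degree p / 2 + ((cmod x)\<^sup>2 - 1) / 2 * (\<Sum>a\<in>#proots p. 1 / (cmod (x - a))\<^sup>2)"
      by (simp add: sum_mset.distrib sum_mset_distrib_left size_proots_complex)
    finally have "((cmod x)\<^sup>2 - 1) / 2 * (\<Sum>a\<in>#proots p. 1 / (cmod (x - a))\<^sup>2) = 0"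
      using arg_cong[OF sum, of Re] c by simp
    moreover have "(\<Sum>a\<in>#proots p. 1 / (cmod (x - a))\<^sup>2) > 0"
      using px p0 by (intro sum_mset_pos[OF ne]) auto
    moreover have "(cmod x)\<^sup>2 \<noteq> 1" using x' by (simp add: power2_eq_1_iff)
      (metis abs_norm_cancel abs_minus_cancel abs_one)
    ultimately show False by simp
  qed
qed

lemma degree_euler_shift:
  assumes "of_nat (degree p) + c \<noteq> 0"
  shows "degree (euler_shift c p) = degree p"
proof (rule antisym)
  show "degree (euler_shift c p) \<le> degree p"
    by (rule degree_le) (auto simp: coeff_euler_shift coeff_eq_0)
  show "degree p \<le> degree (euler_shift c p)"
    using assms by (cases "p = 0") (auto intro!: le_degree simp: coeff_euler_shift)
qed

text \<open>
  A monic polynomial of degree n with all zeros in S is at least d^n in modulus at a point of distance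
  at least d from S. This lower bound survives coefficientwise limits.
\<close>
lemma roots_in_closed_limit:
  fixes p :: "nat \<Rightarrow> complex poly"
  assumes roots: "\<And>m. m \<ge> M \<Longrightarrow> roots_in S (p m)" and "closed S"
    and deg: "\<And>m. m \<ge> M \<Longrightarrow> degree (p m) = n" and lead: "\<And>m. m \<ge> M \<Longrightarrow> lead_coeff (p m) = 1"
    and degq: "degree q \<le> n"
    and lim: "\<And>j. (\<lambda>m. coeff (p m) j) \<longlonglongrightarrow> coeff q j"
  shows "roots_in S q"
  unfolding roots_in_def
proof (intro allI impI, rule ccontr)
  fix z assume z: "poly q z = 0" "z \<notin> S"
  then obtain d where d: "d > 0" "ball z d \<subseteq> - S"
    using \<open>closed S\<close> by (meson open_Compl openE ComplI)
  have "(\<lambda>m. \<Sum>j\<le>n. coeff (p m) j * z ^ j) \<longlonglongrightarrow> (\<Sum>j\<le>n. coeff q j * z ^ j)"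
    by (intro tendsto_intros lim)
  also have "(\<Sum>j\<le>n. coeff q j * z ^ j) = poly q z"
    unfolding poly_altdef by (rule sum.mono_neutral_right) (use degq in \<open>auto simp: coeff_eq_0\<close>)
  finally have "(\<lambda>m. \<Sum>j\<le>n. coeff (p m) j * z ^ j) \<longlonglongrightarrow> 0" using z by simp
  from tendstoD[OF this, of "d ^ n"]
  have "eventually (\<lambda>m. cmod (\<Sum>j\<le>n. coeff (p m) j * z ^ j) < d ^ n) sequentially"
    using d by simp
  then obtain m where m: "m \<ge> M" "cmod (\<Sum>j\<le>n. coeff (p m) j * z ^ j) < d ^ n"
    unfolding eventually_sequentially by (meson nle_le)
  have pm: "(\<Sum>j\<le>n. coeff (p m) j * z ^ j) = poly (p m) z"
    using deg[OF m(1)] by (simp add: poly_altdef)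
  have "d ^ size A \<le> cmod (poly (\<Prod>a\<in>#A. [:- a, 1:]) z)" if "\<And>a. a \<in># A \<Longrightarrow> a \<in> S" for A
    using that
  proof (induction A)
    case (add a A)
    have "d \<le> cmod (z - a)" using d add.prems[of a] by (force simp: dist_norm)
    then have "d * d ^ size A \<le> cmod (z - a) * cmod (poly (\<Prod>a\<in>#A. [:- a, 1:]) z)"
      using add d by (intro mult_mono) auto
    then show ?case by (simp add: norm_mult flip: left_diff_distrib)
  qed simp
  moreover have "a \<in> S" if "a \<in># proots (p m)" for a
    using that roots[OF m(1)] by (cases "p m = 0") (auto simp: roots_in_def)
  ultimately have "d ^ size (proots (p m)) \<le> cmod (poly (\<Prod>a\<in>#proots (p m). [:- a, 1:]) z)"
    by blast
  also have "(\<Prod>a\<in>#proots (p m). [:- a, 1:]) = p m"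
    using complex_poly_decompose_multiset[of "p m"] lead[OF m(1)] by simp
  finally show False using m(2) pm deg[OF m(1)] by (simp add: size_proots_complex)
qed


lemma coeff_mult_hermite:
  "coeff (mult_hermite n s) j =
     exp (- (s / 2) * (of_nat j ^ 2 - of_nat n * of_nat j)) * coeff ([:-1, 1:] ^ n) j"
  by (simp add: mult_hermite_def coeff_mult_heat)

text \<open>
  The product of the two shifts by \<plusminus>w - n/2 multiplies the j-th coefficient by
  (j - n/2)^2 - w^2, which is - (1 + e j (n - j)) / e for the given value of w^2. Iterating this
  factor m times with e = s / (2m) approximates the heat multiplier exp (s j (n - j) / 2). The set S
  is preserved by every step; the limit only has its zeros in a closed superset S'.
\<close>
lemma mult_hermite_roots_in:
  fixes s :: real
  assumes n: "n > 0" and base: "roots_in S ([:-1, 1:] ^ n)" and S': "S \<subseteq> S'" "closed S'"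
    and s: "s \<noteq> 0" and "\<delta> > 0"
    and step: "\<And>e. e * s > 0 \<Longrightarrow> \<bar>e\<bar> < \<delta> \<Longrightarrow> \<exists>w. w\<^sup>2 = of_real ((real n)\<^sup>2 / 4 + 1 / e) \<and>
      (\<forall>p. degree p = n \<longrightarrow> roots_in S p \<longrightarrow>
         roots_in S (euler_shift (w - of_nat n / 2) p) \<and> roots_in S (euler_shift (- w - of_nat n / 2) p))"
  shows "roots_in S' (mult_hermite n (of_real s))"
proof -
  have one_step: "\<exists>q. degree q = n \<and> roots_in S q \<and>
      (\<forall>j. coeff q j = of_real (1 + e * (real j * (real n - real j))) * coeff p j)"
    if e: "e * s > 0" "\<bar>e\<bar> < \<delta>" and p: "degree p = n" "roots_in S p" for e p
  proof -
    have e0: "e \<noteq> 0" using e by auto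
    obtain w where w: "w\<^sup>2 = of_real ((real n)\<^sup>2 / 4 + 1 / e)"
      "\<And>p. degree p = n \<Longrightarrow> roots_in S p \<Longrightarrow> roots_in S (euler_shift (w - of_nat n / 2) p)"
      "\<And>p. degree p = n \<Longrightarrow> roots_in S p \<Longrightarrow> roots_in S (euler_shift (- w - of_nat n / 2) p)"
      using step[OF e] by blast
    define q where "q = smult (- of_real e) (euler_shift (w - of_nat n / 2) (euler_shift (- w - of_nat n / 2) p))"
    \<comment> \<open>The shifts avoid -n, so the degree stays n and the next factor may be applied.\<close>
    have wn: "w\<^sup>2 \<noteq> (of_nat n / 2)\<^sup>2"
    proof
      assume "w\<^sup>2 = (of_nat n / 2)\<^sup>2"
      then have "complex_of_real (1 / e) = 0" unfolding w(1) by (simp add: power_divide)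
      then show False using e0 by simp
    qed
    have ne: "of_nat n + (w - of_nat n / 2) \<noteq> 0" "of_nat n + (- w - of_nat n / 2) \<noteq> 0"
    proof -
      have *: "of_nat n + (w - of_nat n / 2) = w + of_nat n / 2"
        "of_nat n + (- w - of_nat n / 2) = of_nat n / 2 - w" by (simp_all add: field_simps)
      show "of_nat n + (w - of_nat n / 2) \<noteq> 0" "of_nat n + (- w - of_nat n / 2) \<noteq> 0"
        unfolding * using wn by (auto simp: power2_eq_iff add_eq_0_iff)
    qed
    have deg: "degree (euler_shift (- w - of_nat n / 2) p) = n"
      using degree_euler_shift[of p] ne p by simp
    have "roots_in S q"
      using w(2)[OF deg w(3)[OF p]] e0 by (auto simp: roots_in_def q_def)
    moreover have "degree q = n"
      unfolding q_def using e0 degree_euler_shift[of "euler_shift (- w - of_nat n / 2) p"] ne deg by simp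
    moreover have "coeff q j = of_real (1 + e * (real j * (real n - real j))) * coeff p j" for j
    proof -
      have "- of_real e * ((of_nat j + (w - of_nat n / 2)) * (of_nat j + (- w - of_nat n / 2)))
        = - of_real e * ((of_nat j - of_nat n / 2)\<^sup>2 - w\<^sup>2)"
      proof -
        have "(x + (w - h)) * (x + (- w - h)) = (x - h)\<^sup>2 - w\<^sup>2" for x h :: complex
          by (simp add: power2_eq_square algebra_simps)
        then show ?thesis by simp
      qed
      also have "\<dots> = of_real (1 + e * (real j * (real n - real j)))"
        unfolding w(1) using e0 by (simp add: power2_eq_square field_simps)
      finally have *: "- of_real e * ((of_nat j + (w - of_nat n / 2)) * (of_nat j + (- w - of_nat n / 2)))
        = of_real (1 + e * (real j * (real n - real j)))" .
      show ?thesis unfolding *[symmetric] q_def by (simp add: coeff_euler_shift mult.assoc)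
    qed
    ultimately show ?thesis by blast
  qed
  have iter: "\<exists>q. degree q = n \<and> roots_in S q \<and>
      (\<forall>j. coeff q j = of_real ((1 + e * (real j * (real n - real j))) ^ m) * coeff ([:-1, 1:] ^ n) j)"
    if e: "e * s > 0" "\<bar>e\<bar> < \<delta>" for e m
  proof (induction m)
    case 0
    show ?case using base by (intro exI[of _ "[:-1, 1:] ^ n"]) (simp add: degree_linear_power)
  next
    case (Suc m)
    then obtain q where "degree q = n" "roots_in S q"
      and c: "\<forall>j. coeff q j = of_real ((1 + e * (real j * (real n - real j))) ^ m) * coeff ([:-1, 1:] ^ n) j"
      by blast
    with one_step[OF e] obtain r where "degree r = n" "roots_in S r"
      "\<forall>j. coeff r j = of_real (1 + e * (real j * (real n - real j))) * coeff q j" by blast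
    then show ?case using c by (intro exI[of _ r]) (simp add: mult.assoc)
  qed
  \<comment> \<open>For m \<ge> M the step size e = s / (2m) is below \<delta> in modulus.\<close>
  define M where "M = nat \<lceil>\<bar>s\<bar> / \<delta>\<rceil> + 1"
  have M: "m > 0" "s / (2 * real m) * s > 0" "\<bar>s / (2 * real m)\<bar> < \<delta>" if "m \<ge> M" for m
  proof -
    have m: "real m > \<bar>s\<bar> / \<delta>" using that unfolding M_def by linarith
    show m0: "m > 0" using that by (simp add: M_def)
    have "s / (2 * real m) * s = s\<^sup>2 / (2 * real m)" by (simp add: power2_eq_square)
    also have "\<dots> > 0" using m0 s by simp
    finally show "s / (2 * real m) * s > 0" .
    have "\<bar>s\<bar> < \<delta> * real m" using m \<open>\<delta> > 0\<close> by (simp add: field_simps)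
    also have "\<dots> \<le> \<delta> * (2 * real m)" using \<open>\<delta> > 0\<close> by simp
    finally show "\<bar>s / (2 * real m)\<bar> < \<delta>" using m0 by (simp add: field_simps)
  qed
  have "\<forall>m. \<exists>q. m \<ge> M \<longrightarrow> degree q = n \<and> roots_in S q \<and> (\<forall>j. coeff q j =
      of_real ((1 + s / (2 * real m) * (real j * (real n - real j))) ^ m) * coeff ([:-1, 1:] ^ n) j)"
    using iter M by blast
  then obtain q where q: "\<And>m. m \<ge> M \<Longrightarrow> degree (q m) = n" "\<And>m. m \<ge> M \<Longrightarrow> roots_in S (q m)"
    "\<And>m j. m \<ge> M \<Longrightarrow> coeff (q m) j =
      of_real ((1 + s / (2 * real m) * (real j * (real n - real j))) ^ m) * coeff ([:-1, 1:] ^ n) j"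
    by metis
  show ?thesis
  proof (rule roots_in_closed_limit[of M S' q n])
    show "roots_in S' (q m)" if "m \<ge> M" for m using q(2)[OF that] S' by (auto simp: roots_in_def)
    show "degree (q m) = n" if "m \<ge> M" for m using q(1) that .
    show "lead_coeff (q m) = 1" if "m \<ge> M" for m
      using q(1,3)[OF that] by (simp add: coeff_linear_power)
    show "closed S'" by fact
    show "degree (mult_hermite n (of_real s)) \<le> n" by (simp add: degree_mult_hermite)
    fix j
    define x where "x = s / 2 * (real j * (real n - real j))"
    have "(\<lambda>m. (1 + x / real m) ^ m) \<longlonglongrightarrow> exp x"
      by (rule tendsto_exp_limit_sequentially)
    then have "(\<lambda>m. complex_of_real ((1 + x / real m) ^ m) * coeff ([:-1, 1:] ^ n) j) \<longlonglongrightarrow>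
        of_real (exp x) * coeff ([:-1, 1:] ^ n) j"
      by (intro tendsto_intros)
    also have "of_real (exp x) * coeff ([:-1, 1:] ^ n) j = coeff (mult_hermite n (of_real s)) j"
      by (simp add: coeff_mult_hermite x_def exp_of_real[symmetric] power2_eq_square algebra_simps)
    finally show "(\<lambda>m. coeff (q m) j) \<longlonglongrightarrow> coeff (mult_hermite n (of_real s)) j"
      by (rule Lim_transform_eventually)
         (use eventually_ge_at_top[of M] in eventually_elim, simp add: q(3) x_def)
  qed
qed

lemma mult_hermite_0: "mult_hermite n 0 = [:-1, 1:] ^ n"
  by (rule poly_eqI) (simp add: coeff_mult_hermite)

lemma poly_mult_hermite_0: "poly (mult_hermite n s) 0 = (-1) ^ n"
  by (simp add: poly_0_coeff_0 coeff_mult_hermite coeff_0_power)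

lemma roots_in_linear_power: "1 \<in> S \<Longrightarrow> roots_in S ([:-1, 1:] ^ n)"
  by (auto simp: roots_in_def poly_power)

text \<open>
  Here w is real with w > n/2, so both shifts c = \<plusminus>w - n/2 satisfy c > 0 or c < -n. The limit could
  introduce a zero at the origin, which the constant coefficient \<plusminus>1 rules out.
\<close>
lemma mult_hermite_pos_roots:
  fixes s :: real
  assumes "s \<ge> 0" "n > 0"
  shows "roots_in pos_reals (mult_hermite n (of_real s))"
proof (cases "s = 0")
  case True
  then show ?thesis by (auto simp: mult_hermite_0 intro!: roots_in_linear_power image_eqI[of _ _ 1])
next
  case False
  have "roots_in {z. Im z = 0 \<and> Re z \<ge> 0} (mult_hermite n (of_real s))"
  proof (rule mult_hermite_roots_in[where S = pos_reals and \<delta> = 1])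
    fix e :: real assume "e * s > 0" "\<bar>e\<bar> < 1"
    then have e: "e > 0" using assms False by (simp add: zero_less_mult_iff)
    define w where "w = sqrt ((real n)\<^sup>2 / 4 + 1 / e)"
    have "w > sqrt ((real n / 2)\<^sup>2)" unfolding w_def using e by (simp add: power_divide)
    then have w: "w > real n / 2" by simp
    have "(complex_of_real w)\<^sup>2 = of_real ((real n)\<^sup>2 / 4 + 1 / e)"
      using e unfolding w_def of_real_power[symmetric] by (subst real_sqrt_pow2) auto
    moreover have "roots_in pos_reals (euler_shift (of_real w - of_nat n / 2) p) \<and>
        roots_in pos_reals (euler_shift (- of_real w - of_nat n / 2) p)"
      if "degree p = n" "roots_in pos_reals p" for p
      using euler_shift_pos_roots[OF that(2), of "w - real n / 2"]
        euler_shift_pos_roots[OF that(2), of "- w - real n / 2"] w that(1) by simp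
    ultimately show "\<exists>w. w\<^sup>2 = of_real ((real n)\<^sup>2 / 4 + 1 / e) \<and>
      (\<forall>p. degree p = n \<longrightarrow> roots_in pos_reals p \<longrightarrow>
         roots_in pos_reals (euler_shift (w - of_nat n / 2) p) \<and>
         roots_in pos_reals (euler_shift (- w - of_nat n / 2) p))" by blast
  next
    show "closed {z. Im z = 0 \<and> Re z \<ge> 0}"
      by (intro closed_Collect_conj closed_Collect_eq closed_Collect_le continuous_intros)
  qed (use assms False in \<open>auto intro!: roots_in_linear_power image_eqI[of _ _ 1]\<close>)
  moreover have "poly (mult_hermite n (of_real s)) 0 \<noteq> 0" by (simp add: poly_mult_hermite_0)
  ultimately show ?thesis
    unfolding roots_in_def
    by (metis (mono_tags, lifting) mem_Collect_eq complex_is_Real_iff image_eqI greaterThan_iff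
       less_eq_real_def of_real_Re of_real_0)
qed

text \<open>
  For e < 0 of modulus below 4 / n^2 the number w is purely imaginary, so both shifts
  have real part -n/2.
\<close>
lemma mult_hermite_circle_roots:
  fixes s :: real
  assumes "s \<le> 0" "n > 0"
  shows "roots_in unit_circle (mult_hermite n (of_real s))"
proof (cases "s = 0")
  case True
  then show ?thesis by (auto simp: mult_hermite_0 intro!: roots_in_linear_power)
next
  case False
  show ?thesis
  proof (rule mult_hermite_roots_in[where S = unit_circle and \<delta> = "4 / (real n)\<^sup>2"])
    fix e :: real assume "e * s > 0" and e4: "\<bar>e\<bar> < 4 / (real n)\<^sup>2"
    then have e: "e < 0" using assms False by (simp add: zero_less_mult_iff)
    define g where "g = - (real n)\<^sup>2 / 4 - 1 / e"
    have g: "g \<ge> 0" using e e4 assms by (simp add: g_def field_simps)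
    define w where "w = \<i> * of_real (sqrt g)"
    have "w\<^sup>2 = - of_real ((sqrt g)\<^sup>2)" by (simp add: w_def power_mult_distrib)
    also have "\<dots> = of_real ((real n)\<^sup>2 / 4 + 1 / e)" using g by (simp add: g_def)
    finally have "w\<^sup>2 = of_real ((real n)\<^sup>2 / 4 + 1 / e)" .
    moreover have "roots_in unit_circle (euler_shift (w - of_nat n / 2) p) \<and>
        roots_in unit_circle (euler_shift (- w - of_nat n / 2) p)"
      if "degree p = n" "roots_in unit_circle p" for p
      using that assms by (auto intro!: euler_shift_circle_roots simp: w_def)
    ultimately show "\<exists>w. w\<^sup>2 = of_real ((real n)\<^sup>2 / 4 + 1 / e) \<and>
      (\<forall>p. degree p = n \<longrightarrow> roots_in unit_circle p \<longrightarrow>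
         roots_in unit_circle (euler_shift (w - of_nat n / 2) p) \<and>
         roots_in unit_circle (euler_shift (- w - of_nat n / 2) p))" by blast
  qed (use assms False in \<open>auto intro!: roots_in_linear_power\<close>)
qed

section \<open>Integrals against the zero distribution\<close>

lemma sum_mset_eq_sum_count:
  fixes f :: "'a \<Rightarrow> 'b::comm_semiring_1"
  shows "(\<Sum>x\<in>#A. f x) = (\<Sum>x\<in>set_mset A. of_nat (count A x) * f x)"
proof (induction A)
  case (add a A)
  have "(\<Sum>x\<in>set_mset (add_mset a A). of_nat (count (add_mset a A) x) * f x) =
      (\<Sum>x\<in>insert a (set_mset A). of_nat (count A x) * f x + (if x = a then f x else 0))"
    by (intro sum.cong) (auto simp: algebra_simps)
  also have "\<dots> = (\<Sum>x\<in>insert a (set_mset A). of_nat (count A x) * f x) + f a"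
    by (simp add: sum.distrib)
  also have "(\<Sum>x\<in>insert a (set_mset A). of_nat (count A x) * f x) =
      (\<Sum>x\<in>set_mset A. of_nat (count A x) * f x)"
    by (rule sum.mono_neutral_right) (auto simp: not_in_iff)
  finally show ?case using add by (simp add: add.commute)
qed simp

lemma zero_distr_eq_distr_pmf:
  assumes P: "degree P = n" "n > 0"
  shows "zero_distr n P = distr (measure_pmf (pmf_of_multiset (proots P))) borel (\<lambda>z. z)"
proof (rule measure_eqI)
  fix A assume "A \<in> sets (zero_distr n P)"
  then have A: "A \<in> sets borel" by simp
  have sz: "size (proots P) = n" using P by (simp add: size_proots_complex)
  then have ne: "proots P \<noteq> {#}" using P by auto
  let ?p = "pmf_of_multiset (proots P)"
  have "emeasure (distr (measure_pmf ?p) borel (\<lambda>z. z)) A = emeasure ?p A"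
    using A by (subst emeasure_distr) auto
  also have "\<dots> = (\<integral>\<^sup>+x. indicator A x \<partial>?p)" by simp
  also have "\<dots> = (\<Sum>x\<in>set_mset (proots P). indicator A x * ennreal (pmf ?p x))"
    using ne by (subst nn_integral_measure_pmf_finite) auto
  also have "\<dots> = (\<Sum>x\<in>set_mset (proots P). ennreal (1 / real n) * (of_nat (count (proots P) x) * indicator A x))"
  proof (intro sum.cong refl)
    fix x
    have "ennreal (pmf ?p x) = ennreal (1 / real n) * of_nat (count (proots P) x)"
      using ne by (simp add: sz ennreal_of_nat_eq_real_of_nat flip: ennreal_mult)
    then show "indicator A x * ennreal (pmf ?p x) =
       ennreal (1 / real n) * (of_nat (count (proots P) x) * indicator A x)"
      by (simp add: mult_ac)
  qed
  also have "\<dots> = ennreal (1 / real n) * (\<Sum>z\<in>#proots P. indicator A z)"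
    by (simp only: sum_mset_eq_sum_count sum_distrib_left)
  finally show "emeasure (zero_distr n P) A = emeasure (distr (measure_pmf ?p) borel (\<lambda>z. z)) A"
    using A by (simp add: emeasure_zero_distr)
qed simp

lemma
  fixes f :: "complex \<Rightarrow> 'b::{real_normed_field,banach,second_countable_topology}"
  assumes P: "degree P = n" "n > 0" and f: "f \<in> borel_measurable borel"
  shows integrable_zero_distr: "integrable (zero_distr n P) f"
    and integral_zero_distr: "integral\<^sup>L (zero_distr n P) f = (\<Sum>z\<in>#proots P. f z) / of_nat n"
proof -
  have sz: "size (proots P) = n" using P by (simp add: size_proots_complex)
  then have ne: "proots P \<noteq> {#}" using P by auto
  let ?p = "pmf_of_multiset (proots P)"
  have "integrable (measure_pmf ?p) f"
    using ne by (intro integrable_measure_pmf_finite) auto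
  then show "integrable (zero_distr n P) f"
    unfolding zero_distr_eq_distr_pmf[OF P] by (subst integrable_distr_eq) (auto simp: f)
  have "integral\<^sup>L (zero_distr n P) f = integral\<^sup>L (measure_pmf ?p) f"
    unfolding zero_distr_eq_distr_pmf[OF P] by (subst integral_distr) (auto simp: f)
  also have "\<dots> = (\<Sum>z\<in>set_mset (proots P). pmf ?p z *\<^sub>R f z)"
    using ne by (intro integral_measure_pmf) auto
  also have "\<dots> = (\<Sum>z\<in>set_mset (proots P). of_nat (count (proots P) z) * f z) / of_nat n"
    using ne by (simp add: sz sum_divide_distrib scaleR_conv_of_real)
  finally show "integral\<^sup>L (zero_distr n P) f = (\<Sum>z\<in>#proots P. f z) / of_nat n"
    by (simp add: sum_mset_eq_sum_count)
qed

lemma AE_zero_distr: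
  assumes P: "degree P = n" "n > 0" and Q: "\<And>z. poly P z = 0 \<Longrightarrow> Q z"
  shows "AE z in zero_distr n P. Q z"
proof -
  have sz: "size (proots P) = n" using P by (simp add: size_proots_complex)
  then have ne: "proots P \<noteq> {#}" using P by auto
  have "P \<noteq> 0" using P by auto
  define R where "R = {z. poly P z = 0}"
  have "finite R" unfolding R_def by (rule poly_roots_finite) fact
  then have "R \<in> sets borel" by (simp add: finite_imp_closed borel_closed)
  have "AE z in measure_pmf (pmf_of_multiset (proots P)). z \<in> R"
    using ne \<open>P \<noteq> 0\<close> by (auto simp: AE_measure_pmf_iff R_def)
  then have "AE z in zero_distr n P. z \<in> R"
    unfolding zero_distr_eq_distr_pmf[OF P] using \<open>R \<in> sets borel\<close> by (subst AE_distr_iff) auto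
  then show ?thesis using Q by (auto simp: R_def)
qed


section \<open>Power sums and the inversion symmetry of the zeros\<close>

lemma reflect_poly_linear: "reflect_poly [:- z, 1:] = [:1, - z :: complex:]"
  by (cases "z = 0") (simp_all add: reflect_poly_def)

definition power_sum_fps :: "complex multiset \<Rightarrow> complex fps" where
  "power_sum_fps A = Abs_fps (\<lambda>k. if k = 0 then 0 else \<Sum>z\<in>#A. z ^ k)"

text \<open>
  Newton's identities in generating form: x d/dx maps the factor 1 - z x to
  - (\<Sum> z^k x^k) (1 - z x), the sum being over k \<ge> 1, and logarithmic derivatives of products add up.
\<close>
lemma newton_power_sums:
  fixes A :: "complex multiset"
  defines "G \<equiv> fps_of_poly (reflect_poly (\<Prod>z\<in>#A. [:- z, 1:]))"
  shows "fps_theta G = - power_sum_fps A * G"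
  unfolding G_def
proof (induction A)
  case empty
  show ?case by (simp add: fps_theta_def power_sum_fps_def fps_eq_iff fps_zero_def[symmetric])
next
  case (add a A)
  define G where "G = fps_of_poly (reflect_poly (\<Prod>z\<in>#A. [:- z, 1:]))"
  define L where "L = fps_of_poly [:1, - a:]"
  have G: "fps_of_poly (reflect_poly (\<Prod>z\<in>#add_mset a A. [:- z, 1:])) = L * G"
    by (simp only: image_mset_add_mset prod_mset.add_mset reflect_poly_mult reflect_poly_linear
        fps_of_poly_mult G_def L_def)
  have ps: "power_sum_fps (add_mset a A) = power_sum_fps {#a#} + power_sum_fps A"
    by (simp add: power_sum_fps_def fps_eq_iff)
  have "fps_theta L = - power_sum_fps {#a#} * L"
  proof (rule fps_ext)
    fix k
    have L: "L = 1 - fps_const a * fps_X"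
      by (simp add: L_def fps_of_poly_pCons)
    have "power_sum_fps {#a#} * L = power_sum_fps {#a#} - fps_const a * (fps_X * power_sum_fps {#a#})"
      by (simp add: L algebra_simps)
    then show "fps_nth (fps_theta L) k = fps_nth (- power_sum_fps {#a#} * L) k"
      by (cases k; cases "k - 1") (auto simp: L power_sum_fps_def)
  qed
  then show ?case
    unfolding G ps fps_theta_mult using add by (simp add: G_def[symmetric] algebra_simps)
qed

lemma monic_eq_prod_roots:
  assumes "lead_coeff (P :: complex poly) = 1"
  shows "(\<Prod>z\<in>#proots P. [:- z, 1:]) = P"
  using complex_poly_decompose_multiset[of P] assms by simp

lemma lead_coeff_mult_hermite: "lead_coeff (mult_hermite n s) = 1"
  by (simp add: degree_mult_hermite coeff_mult_hermite coeff_linear_power power2_eq_square)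

lemma coeff_reflect_mult_hermite:
  "coeff (reflect_poly (mult_hermite n s)) j =
     (-1) ^ j * of_nat (n choose j) * exp (- (s / 2) * (of_nat j ^ 2 - of_nat n * of_nat j))"
proof (cases "j \<le> n")
  case True
  then have "coeff ([:-1, 1:] ^ n :: complex poly) (n - j) = of_nat (n choose j) * (-1) ^ j"
    using coeff_linear_poly_power[of "n - j" n "-1 :: complex" 1]
    by (simp add: binomial_symmetric[symmetric])
  moreover have "of_nat (n - j) ^ 2 - of_nat n * of_nat (n - j) = (of_nat j ^ 2 - of_nat n * of_nat j :: complex)"
    using True by (simp add: of_nat_diff power2_eq_square algebra_simps)
  ultimately show ?thesis using True
    by (simp add: coeff_reflect_poly degree_mult_hermite coeff_mult_hermite)
qed (simp add: coeff_reflect_poly degree_mult_hermite)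

text \<open>
  The multiplier exp (- s/2 (j^2 - n j)) and the binomial coefficients are invariant under j to n - j,
  so the polynomial is self-reciprocal up to sign. This is the source of the invariance under z to 1/z.
\<close>
lemma reflect_mult_hermite: "reflect_poly (mult_hermite n s) = smult ((-1) ^ n) (mult_hermite n s)"
proof (rule poly_eqI)
  fix j
  show "coeff (reflect_poly (mult_hermite n s)) j = coeff (smult ((-1) ^ n) (mult_hermite n s)) j"
  proof (cases "j \<le> n")
    case True
    have "(-1) ^ n * (-1) ^ (n - j) = ((-1) ^ j :: complex)"
    proof -
      have "(-1) ^ n = (-1) ^ j * ((-1) ^ (n - j) :: complex)"
        using True by (simp flip: power_add)
      then show ?thesis by (simp add: mult.assoc flip: power_mult_distrib)
    qed
    then show ?thesis using True coeff_linear_poly_power[of j n "-1 :: complex" 1]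
      by (simp add: coeff_reflect_mult_hermite coeff_mult_hermite mult_ac)
  next
    case False
    then show ?thesis
      by (simp add: coeff_reflect_mult_hermite coeff_eq_0 degree_mult_hermite)
  qed
qed

lemma proots_reflect_prod_linear:
  fixes A :: "complex multiset"
  assumes "0 \<notin># A"
  shows "reflect_poly (\<Prod>z\<in>#A. [:- z, 1:]) \<noteq> 0 \<and>
    proots (reflect_poly (\<Prod>z\<in>#A. [:- z, 1:])) = image_mset (\<lambda>z. 1 / z) A"
  using assms
proof (induction A)
  case (add a A)
  then have a: "a \<noteq> 0" by auto
  have l: "[:1, - a:] = smult (- a) [:- (1 / a), 1:]" using a by simp
  have "proots [:1, - a:] = {#1 / a#}" unfolding l using a by (subst proots_smult) auto
  moreover have "[:1, - a:] \<noteq> 0" by simp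
  moreover have "reflect_poly (\<Prod>z\<in>#add_mset a A. [:- z, 1:]) =
      [:1, - a:] * reflect_poly (\<Prod>z\<in>#A. [:- z, 1:])"
    by (simp only: image_mset_add_mset prod_mset.add_mset reflect_poly_mult reflect_poly_linear)
  moreover have "reflect_poly (\<Prod>z\<in>#A. [:- z, 1:]) \<noteq> 0"
    "proots (reflect_poly (\<Prod>z\<in>#A. [:- z, 1:])) = image_mset (\<lambda>z. 1 / z) A"
    using add by auto
  ultimately show ?case by (simp add: proots_mult del: mult_pCons_left)
qed simp

lemma proots_mult_hermite_inverse:
  "image_mset (\<lambda>z. 1 / z) (proots (mult_hermite n s)) = proots (mult_hermite n s)"
proof -
  let ?P = "mult_hermite n s"
  have "?P \<noteq> 0" using lead_coeff_mult_hermite[of n s] by auto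
  then have "0 \<notin># proots ?P" by (simp add: poly_mult_hermite_0)
  from proots_reflect_prod_linear[OF this]
  show ?thesis by (simp add: monic_eq_prod_roots[OF lead_coeff_mult_hermite] reflect_mult_hermite)
qed

text \<open>
  The reflected polynomial, whose zeros are the 1/z, is the heat flow at time s with the variable
  scaled by c = - e^(s/2): the linear part of the exponent s j (n - j) / (2n) is absorbed in
  the scaling and the quadratic part is the heat multiplier. Comparing the logarithmic derivatives of
  both descriptions gives the power sums.
\<close>
lemma power_sum_mult_hermite:
  assumes n: "n > 0" and k: "k > 0"
  shows "(\<Sum>z\<in>#proots (mult_hermite n (s / of_nat n)). z ^ k) / of_nat n =
     - ((- exp (s / 2)) ^ k) * fps_nth (log_deriv_fps n s) k"
proof -
  define P where "P = mult_hermite n (s / of_nat n)"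
  define c where "c = - exp (s / 2)"
  define sc where "sc A = Abs_fps (\<lambda>k. c ^ k * fps_nth A k)" for A :: "complex fps"
  have sc_mult: "sc (A * B) = sc A * sc B" for A B
  proof (rule fps_ext)
    fix k
    have "c ^ k = c ^ i * c ^ (k - i)" if "i \<le> k" for i using that by (simp flip: power_add)
    then show "fps_nth (sc (A * B)) k = fps_nth (sc A * sc B) k"
      by (auto simp: sc_def fps_mult_nth sum_distrib_left mult_ac intro!: sum.cong)
  qed
  have sc_theta: "fps_theta (sc A) = sc (fps_theta A)" for A
    by (simp add: sc_def fps_eq_iff mult_ac)
  have sc_nat: "sc (of_nat m * A) = of_nat m * sc A" for m A
    by (simp add: sc_def fps_eq_iff flip: fps_of_nat)
  have sc_of_nat: "sc (of_nat m) = of_nat m" for m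
    by (simp add: sc_def fps_eq_iff flip: fps_of_nat)
  have heat: "fps_of_poly (reflect_poly P) = sc (heat_fps n s)"
  proof (rule fps_ext)
    fix j
    have "exp (- (s / of_nat n / 2) * (of_nat j ^ 2 - of_nat n * of_nat j)) =
       exp (s / 2) ^ j * exp (- s * of_nat j ^ 2 / (2 * of_nat n))"
    proof -
      have "- (s / of_nat n / 2) * (of_nat j ^ 2 - of_nat n * of_nat j) =
          of_nat j * (s / 2) + - s * of_nat j ^ 2 / (2 * of_nat n)"
        using n by (simp add: field_simps)
      then show ?thesis by (simp only: exp_add exp_of_nat_mult)
    qed
    moreover have "c ^ j = (-1) ^ j * exp (s / 2) ^ j"
      unfolding c_def by (rule power_minus)
    ultimately show "fps_nth (fps_of_poly (reflect_poly P)) j = fps_nth (sc (heat_fps n s)) j"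
      by (simp add: sc_def heat_fps_def P_def coeff_reflect_mult_hermite)
  qed
  \<comment> \<open>Both logarithmic derivatives belong to the same nonzero series, which can be cancelled.\<close>
  have nz: "sc (heat_fps n s) \<noteq> 0"
  proof -
    have "fps_nth (sc (heat_fps n s)) 0 \<noteq> 0" by (simp add: sc_def heat_fps_def)
    then show ?thesis by auto
  qed
  have "fps_theta (sc (heat_fps n s)) = - power_sum_fps (proots P) * sc (heat_fps n s)"
    using newton_power_sums[of "proots P"]
    by (simp add: P_def monic_eq_prod_roots[OF lead_coeff_mult_hermite] heat[unfolded P_def])
  moreover have "fps_theta (sc (heat_fps n s)) = of_nat n * sc (log_deriv_fps n s) * sc (heat_fps n s)"
    by (simp add: sc_theta log_deriv_fps_eq[OF n] sc_nat sc_mult sc_of_nat mult.assoc)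
  ultimately have "- power_sum_fps (proots P) = of_nat n * sc (log_deriv_fps n s)"
    using nz by (metis mult_right_cancel)
  from arg_cong[OF this, of "\<lambda>A. fps_nth A k"]
  have "- (\<Sum>z\<in>#proots P. z ^ k) = of_nat n * (c ^ k * fps_nth (log_deriv_fps n s) k)"
    using k by (simp add: power_sum_fps_def sc_def flip: fps_of_nat)
  then have "(\<Sum>z\<in>#proots P. z ^ k) = of_nat n * (- (c ^ k) * fps_nth (log_deriv_fps n s) k)"
    by (metis minus_minus mult_minus_left mult_minus_right)
  then show ?thesis using n by (simp add: P_def c_def)
qed

text \<open>
  The k-th moment of the limit, with the Taylor coefficient taken in formal power series.
\<close>
definition limit_moment :: "real \<Rightarrow> nat \<Rightarrow> complex" where
  "limit_moment s k = exp (of_real s * of_nat k / 2) / of_nat k *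
     fps_nth ((1 + fps_X) ^ k * fps_exp (of_real s * of_nat k)) (k - 1)"

lemma limit_moment_sum:
  assumes "k > 0"
  shows "limit_moment s k = exp (of_real s * of_nat k / 2) / of_nat k *
    (\<Sum>j=0..k-1. of_nat (k choose (j + 1)) * (of_real s * of_nat k) ^ j / fact j)"
  unfolding limit_moment_def fps_one_plus_X_exp_nth
proof (intro arg_cong2[where f = "(*)"] refl sum.cong)
  fix j assume "j \<in> {0..k-1}"
  then have "k choose (k - 1 - j) = k choose (j + 1)"
    using assms by (subst binomial_symmetric) (auto intro!: arg_cong[where f = "binomial k"])
  then show "of_nat (k choose (k - 1 - j)) * (of_real s * of_nat k) ^ j / fact j =
    (of_nat (k choose (j + 1)) * (of_real s * of_nat k) ^ j / fact j :: complex)" by simp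
qed

lemma power_sum_tendsto:
  assumes k: "k > 0"
  shows "(\<lambda>n. (\<Sum>z\<in>#proots (mult_hermite n (of_real s / of_nat n)). z ^ k) / of_nat n)
    \<longlonglongrightarrow> limit_moment s k"
proof -
  have "(\<lambda>n. - ((- exp (of_real s / 2)) ^ k) * fps_nth (log_deriv_fps n (of_real s)) k) \<longlonglongrightarrow>
      - ((- exp (of_real s / 2)) ^ k) * burgers_coeff k (of_real s)"
    by (intro tendsto_intros log_deriv_coeff_tendsto)
  also have "- ((- exp (of_real s / 2)) ^ k) * burgers_coeff k (of_real s) = limit_moment s k"
    using k unfolding burgers_coeff_def limit_moment_def power_minus[of "exp _"]
    by (simp add: exp_of_nat_mult[symmetric] mult.commute power_add[symmetric]
         flip: power_mult_distrib)
  finally show ?thesis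
    by (rule Lim_transform_eventually)
       (use eventually_gt_at_top[of 0] in eventually_elim, simp add: power_sum_mult_hermite k)
qed

text \<open>
  Exponential growth of the moments is what makes the support of the limit bounded. It follows from
  k choose (j + 1) \<le> 2^k and the exponential series.
\<close>
lemma norm_limit_moment_le:
  assumes k: "k > 0" and s: "s \<ge> 0"
  shows "norm (limit_moment s k) \<le> (2 * exp (3 / 2 * s)) ^ k"
proof -
  have "norm (\<Sum>j=0..k-1. of_nat (k choose (j + 1)) * (of_real s * of_nat k) ^ j / fact j :: complex)
     \<le> (\<Sum>j=0..k-1. 2 ^ k * ((s * real k) ^ j / fact j))"
  proof (rule sum_norm_le)
    fix j assume "j \<in> {0..k-1}"
    have "real (k choose (j + 1)) \<le> 2 ^ k"
      using binomial_le_pow2[of k "j + 1"] by (metis of_nat_le_iff of_nat_numeral of_nat_power)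
    then have "real (k choose (j + 1)) * ((s * real k) ^ j / fact j) \<le> 2 ^ k * ((s * real k) ^ j / fact j)"
      using s by (intro mult_right_mono) auto
    then show "norm (of_nat (k choose (j + 1)) * (of_real s * of_nat k) ^ j / fact j :: complex)
       \<le> 2 ^ k * ((s * real k) ^ j / fact j)"
      using s by (simp add: norm_mult norm_divide norm_power)
  qed
  also have "\<dots> \<le> 2 ^ k * exp (s * real k)"
  proof -
    have "(\<Sum>j=0..k-1. (s * real k) ^ j / fact j) \<le> (\<Sum>j. (s * real k) ^ j / fact j)"
      using s summable_exp[of "s * real k"]
      by (intro sum_le_suminf) (auto simp: field_simps)
    also have "\<dots> = exp (s * real k)" by (simp add: exp_def field_simps)
    finally show ?thesis unfolding sum_distrib_left[symmetric] by (intro mult_left_mono) auto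
  qed
  finally have "norm (limit_moment s k) \<le> exp (s * real k / 2) / real k * (2 ^ k * exp (s * real k))"
    unfolding limit_moment_sum[OF k] norm_mult using s
    by (intro mult_mono) (auto simp: norm_divide)
  also have "\<dots> \<le> exp (s * real k / 2) * (2 ^ k * exp (s * real k))"
    using k by (intro mult_right_mono) (auto simp: divide_simps)
  also have "\<dots> = (2 * exp (3 / 2 * s)) ^ k"
    by (simp add: power_mult_distrib exp_of_nat_mult[symmetric] exp_add[symmetric] field_simps)
  finally show ?thesis .
qed

section \<open>Determination of the limit by its moments\<close>

text \<open>
  The open sets are an intersection-stable generator, and the indicator of an open set U is the
  pointwise increasing limit of the continuous functions min 1 (n dist (x, complement of U)).
\<close>
lemma measure_eqI_continuous_bounded:
  fixes \<mu> \<nu> :: "'a::metric_space measure"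
  assumes sets: "sets \<mu> = sets borel" "sets \<nu> = sets borel" and fin: "finite_measure \<mu>" "finite_measure \<nu>"
    and eq: "\<And>f :: 'a \<Rightarrow> real. continuous_on UNIV f \<Longrightarrow> bounded (range f) \<Longrightarrow> integral\<^sup>L \<mu> f = integral\<^sup>L \<nu> f"
  shows "\<mu> = \<nu>"
proof (rule measure_eqI_generator_eq[where E = "{U. open U}" and \<Omega> = UNIV and A = "\<lambda>_. UNIV"])
  fix U :: "'a set" assume "U \<in> {U. open U}"
  then have U: "open U" by simp
  interpret \<mu>: finite_measure \<mu> by fact
  interpret \<nu>: finite_measure \<nu> by fact
  show "emeasure \<mu> U = emeasure \<nu> U"
  proof (cases "U = UNIV")
    case True
    have "measure \<mu> UNIV = measure \<nu> UNIV"
      using eq[of "\<lambda>_. 1"] sets_eq_imp_space_eq[OF sets(1)] sets_eq_imp_space_eq[OF sets(2)]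
      by (simp add: image_constant_conv)
    then show ?thesis using True by (simp add: \<mu>.emeasure_eq_measure \<nu>.emeasure_eq_measure)
  next
    case False
    define f where "f n x = min 1 (real n * infdist x (- U))" for n x
    have cont: "continuous_on UNIV (f n)" for n
      unfolding f_def by (intro continuous_intros)
    have f01: "0 \<le> f n x" "f n x \<le> 1" for n x by (auto simp: f_def infdist_nonneg)
    have lim: "(\<lambda>n. f n x) \<longlonglongrightarrow> indicator U x" for x
    proof (cases "x \<in> U")
      case True
      then have "infdist x (- U) > 0"
        using False in_closed_iff_infdist_zero[of "- U" x] U infdist_nonneg[of x "- U"]
        by (auto simp: less_le closed_Compl)
      then have "eventually (\<lambda>n. real n * infdist x (- U) \<ge> 1) sequentially"
        by (intro eventually_sequentiallyI[of "nat \<lceil>1 / infdist x (- U)\<rceil>"])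
           (simp add: field_simps ceiling_le_iff nat_le_iff)
      then have "eventually (\<lambda>n. f n x = indicator U x) sequentially"
        by eventually_elim (use True in \<open>simp add: f_def\<close>)
      then show ?thesis by (rule tendsto_eventually)
    next
      case False
      then show ?thesis by (simp add: f_def)
    qed
    have int_lim: "(\<lambda>n. integral\<^sup>L N (f n)) \<longlonglongrightarrow> measure N U"
      if "sets N = sets borel" "finite_measure N" for N :: "'a measure"
    proof -
      interpret finite_measure N by fact
      have "(\<lambda>n. integral\<^sup>L N (f n)) \<longlonglongrightarrow> integral\<^sup>L N (indicator U)"
      proof (rule integral_dominated_convergence[where w = "\<lambda>_. 1"])
        show "f n \<in> borel_measurable N" for n
          using borel_measurable_continuous_onI[OF cont[of n]] that(1) by (simp cong: measurable_cong_sets)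
        show "indicator U \<in> borel_measurable N"
          by (rule borel_measurable_indicator) (simp add: that(1) U borel_open)
      qed (use lim f01 in auto)
      then show ?thesis using U that(1) by simp
    qed
    have "bounded (range (f n))" for n
      using f01[of n] by (intro boundedI[of _ 1]) auto
    then have "integral\<^sup>L \<mu> (f n) = integral\<^sup>L \<nu> (f n)" for n using eq cont by blast
    then have "measure \<mu> U = measure \<nu> U"
      using int_lim[OF sets(1) fin(1)] int_lim[OF sets(2) fin(2)] LIMSEQ_unique by auto
    then show ?thesis by (simp add: \<mu>.emeasure_eq_measure \<nu>.emeasure_eq_measure)
  qed
next
  show "Int_stable {U :: 'a set. open U}" by (auto simp: Int_stable_def)
  show "sets \<mu> = sigma_sets UNIV {U. open U}" "sets \<nu> = sigma_sets UNIV {U. open U}"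
    using sets by (simp_all add: borel_def)
  show "emeasure \<mu> UNIV \<noteq> \<infinity>" for i :: nat
    using finite_measure.emeasure_finite[OF fin(1)] by simp
qed auto

text \<open>
  The hypothesis says that conjugates may be eliminated on S under the real part. On the real line
  the conjugate of z is z, on the unit circle it is 1/z; this is the only property of these
  two sets that determinacy of measures by holomorphic moments needs.
\<close>
lemma Re_poly_mult_cnj_poly:
  fixes S :: "complex set" and p q :: "complex poly"
  assumes star: "\<And>c i j. \<exists>r. \<forall>z\<in>S. Re (c * z ^ i * cnj z ^ j) = Re (poly r z)"
  shows "\<exists>r. \<forall>z\<in>S. Re (poly p z * cnj (poly q z)) = Re (poly r z)"
proof -
  obtain r where r: "\<And>c i j z. z \<in> S \<Longrightarrow> Re (c * z ^ i * cnj z ^ j) = Re (poly (r c i j) z)"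
    using star by metis
  define t where "t = (\<Sum>i\<le>degree p. \<Sum>j\<le>degree q. r (coeff p i * cnj (coeff q j)) i j)"
  have "Re (poly p z * cnj (poly q z)) = Re (poly t z)" if "z \<in> S" for z
  proof -
    have "poly p z * cnj (poly q z) =
        (\<Sum>i\<le>degree p. \<Sum>j\<le>degree q. coeff p i * cnj (coeff q j) * z ^ i * cnj z ^ j)"
      unfolding poly_altdef cnj_sum sum_product by (simp add: mult_ac)
    then show ?thesis by (simp only: t_def poly_sum Re_sum r[OF that])
  qed
  then show ?thesis by blast
qed

text \<open>
  The identity Re a Re b = Re (a b + a b*) / 2 (with b* the conjugate of b) reduces
  closure under products to the previous lemma. Points are separated by the real parts of z and -i z.
\<close>
lemma function_ring_on_Re_poly:
  fixes S :: "complex set"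
  assumes "compact S" and star: "\<And>c i j. \<exists>r. \<forall>z\<in>S. Re (c * z ^ i * cnj z ^ j) = Re (poly r z)"
  shows "function_ring_on {f. \<exists>p. \<forall>z\<in>S. f z = Re (poly p z)} S"
proof
  show "compact S" by fact
next
  fix f assume "f \<in> {f. \<exists>p. \<forall>z\<in>S. f z = Re (poly p z)}"
  then obtain p where "\<And>z. z \<in> S \<Longrightarrow> f z = Re (poly p z)" by blast
  moreover have "continuous_on S (\<lambda>z. Re (poly p z))" by (intro continuous_intros)
  ultimately show "continuous_on S f" by (metis (no_types, lifting) continuous_on_cong)
next
  fix f g assume "f \<in> {f. \<exists>p. \<forall>z\<in>S. f z = Re (poly p z)}" "g \<in> {f. \<exists>p. \<forall>z\<in>S. f z = Re (poly p z)}"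
  then obtain p q where p: "\<And>z. z \<in> S \<Longrightarrow> f z = Re (poly p z)" and q: "\<And>z. z \<in> S \<Longrightarrow> g z = Re (poly q z)"
    by blast
  show "(\<lambda>z. f z + g z) \<in> {f. \<exists>p. \<forall>z\<in>S. f z = Re (poly p z)}"
    using p q by (auto intro!: exI[of _ "p + q"])
  obtain r where r: "\<And>z. z \<in> S \<Longrightarrow> Re (poly p z * cnj (poly q z)) = Re (poly r z)"
    using Re_poly_mult_cnj_poly[OF star] by blast
  have "f z * g z = Re (poly (smult (1/2) (p * q + r)) z)" if "z \<in> S" for z
    using r[OF that] p[OF that] q[OF that] by (simp add: field_simps)
  then show "(\<lambda>z. f z * g z) \<in> {f. \<exists>p. \<forall>z\<in>S. f z = Re (poly p z)}" by blast
next
  fix c :: real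
  show "(\<lambda>_. c) \<in> {f. \<exists>p. \<forall>z\<in>S. f z = Re (poly p z)}"
    by (auto intro!: exI[of _ "[:of_real c:]"])
next
  fix x y :: complex assume "x \<noteq> y"
  then have "Re (poly [:0, 1:] x) \<noteq> Re (poly [:0, 1:] y) \<or> Re (poly [:0, - \<i>:] x) \<noteq> Re (poly [:0, - \<i>:] y)"
    by (simp add: complex_eq_iff)
  then show "\<exists>f\<in>{f. \<exists>p. \<forall>z\<in>S. f z = Re (poly p z)}. f x \<noteq> f y"
  proof
    assume "Re (poly [:0, 1:] x) \<noteq> Re (poly [:0, 1:] y)"
    then show ?thesis by (intro bexI[of _ "\<lambda>z. Re (poly [:0, 1:] z)"]) blast+
  next
    assume "Re (poly [:0, - \<i>:] x) \<noteq> Re (poly [:0, - \<i>:] y)"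
    then show ?thesis by (intro bexI[of _ "\<lambda>z. Re (poly [:0, - \<i>:] z)"]) blast+
  qed
qed

lemma integrable_continuous_AE_compact:
  fixes f :: "'a::metric_space \<Rightarrow> 'b::{banach,second_countable_topology}"
  assumes "finite_measure \<mu>" "sets \<mu> = sets borel" "compact S" "AE z in \<mu>. z \<in> S" "continuous_on UNIV f"
  shows "integrable \<mu> f"
proof -
  interpret finite_measure \<mu> by fact
  have "bounded (f ` S)"
    using assms by (intro compact_imp_bounded compact_continuous_image) (auto intro: continuous_on_subset)
  then obtain B where "\<And>z. z \<in> S \<Longrightarrow> norm (f z) \<le> B" by (auto simp: bounded_iff)
  moreover have "f \<in> borel_measurable \<mu>"
    using borel_measurable_continuous_onI[OF assms(5)] assms(2) by (simp cong: measurable_cong_sets)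
  ultimately show ?thesis
    using assms(4) by (intro integrable_const_bound[where B = B]) auto
qed

text \<open>
  By the Stone-Weierstrass theorem, continuous functions on S are uniform limits of real parts of
  polynomials, whose integrals are determined by the moments.
\<close>
lemma moments_determine_measure:
  fixes \<mu> \<nu> :: "complex measure"
  assumes sets: "sets \<mu> = sets borel" "sets \<nu> = sets borel" and prob: "prob_space \<mu>" "prob_space \<nu>"
    and S: "compact S" "AE z in \<mu>. z \<in> S" "AE z in \<nu>. z \<in> S"
    and star: "\<And>c i j. \<exists>r. \<forall>z\<in>S. Re (c * z ^ i * cnj z ^ j) = Re (poly r z)"
    and mom: "\<And>k. k \<ge> 1 \<Longrightarrow> integral\<^sup>L \<mu> (\<lambda>z. z ^ k) = integral\<^sup>L \<nu> (\<lambda>z. z ^ k)"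
  shows "\<mu> = \<nu>"
proof (rule measure_eqI_continuous_bounded[OF sets])
  interpret \<mu>: prob_space \<mu> by fact
  interpret \<nu>: prob_space \<nu> by fact
  show "finite_measure \<mu>" "finite_measure \<nu>" by unfold_locales
  fix f :: "complex \<Rightarrow> real"
  assume f: "continuous_on UNIV f"
  interpret R: function_ring_on "{f. \<exists>p. \<forall>z\<in>S. f z = Re (poly p z)}" S
    by (rule function_ring_on_Re_poly[OF S(1) star])
  have close: "\<bar>integral\<^sup>L N f - integral\<^sup>L N (\<lambda>z. Re (poly p z))\<bar> \<le> e"
    if "prob_space N" "sets N = sets borel" "AE z in N. z \<in> S" "\<And>z. z \<in> S \<Longrightarrow> \<bar>f z - Re (poly p z)\<bar> < e" for N p e
  proof -
    interpret N: prob_space N by fact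
    note int = integrable_continuous_AE_compact[OF N.finite_measure_axioms that(2) S(1) that(3)]
    have p: "continuous_on UNIV (\<lambda>z. Re (poly p z))" by (intro continuous_intros)
    have fp: "integrable N (\<lambda>z. f z - Re (poly p z))"
      by (intro Bochner_Integration.integrable_diff int f p)
    have "\<bar>integral\<^sup>L N (\<lambda>z. f z - Re (poly p z))\<bar> \<le> integral\<^sup>L N (\<lambda>z. \<bar>f z - Re (poly p z)\<bar>)"
      by (rule integral_abs_bound)
    also have "\<dots> \<le> integral\<^sup>L N (\<lambda>_. e)"
      using fp that(3,4) by (intro integral_mono_AE) (auto elim!: eventually_mono intro: less_imp_le)
    also have "\<dots> = e" by (simp add: N.prob_space)
    finally show ?thesis by (simp add: Bochner_Integration.integral_diff int f p)
  qed
  have moment: "integral\<^sup>L N (\<lambda>z. Re (poly p z)) = Re (\<Sum>k\<le>degree p. coeff p k * integral\<^sup>L N (\<lambda>z. z ^ k))"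
    if "prob_space N" "sets N = sets borel" "AE z in N. z \<in> S" for N p
  proof -
    interpret N: prob_space N by fact
    note int = integrable_continuous_AE_compact[OF N.finite_measure_axioms that(2) S(1) that(3)]
    have "integral\<^sup>L N (\<lambda>z. Re (poly p z)) = Re (integral\<^sup>L N (poly p))"
      by (intro integral_Re int continuous_intros)
    also have "integral\<^sup>L N (poly p) = integral\<^sup>L N (\<lambda>z. \<Sum>k\<le>degree p. coeff p k * z ^ k)"
      by (simp add: poly_altdef[abs_def])
    also have "\<dots> = (\<Sum>k\<le>degree p. coeff p k * integral\<^sup>L N (\<lambda>z. z ^ k))"
      by (subst Bochner_Integration.integral_sum) (auto intro!: int continuous_intros)
    finally show ?thesis .
  qed
  have mom': "integral\<^sup>L \<mu> (\<lambda>z. z ^ k) = integral\<^sup>L \<nu> (\<lambda>z. z ^ k)" for k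
    using mom[of k] by (cases k) (auto simp: \<mu>.prob_space \<nu>.prob_space)
  have "\<bar>integral\<^sup>L \<mu> f - integral\<^sup>L \<nu> f\<bar> \<le> e" if "e > 0" for e
  proof -
    have "\<exists>g\<in>{f. \<exists>p. \<forall>z\<in>S. f z = Re (poly p z)}. \<forall>z\<in>S. \<bar>f z - g z\<bar> < e / 2"
      by (rule R.Stone_Weierstrass_basic) (use that f in \<open>auto intro: continuous_on_subset\<close>)
    then obtain g p where "\<forall>z\<in>S. \<bar>f z - g z\<bar> < e / 2" "\<forall>z\<in>S. g z = Re (poly p z)" by blast
    then have p: "\<And>z. z \<in> S \<Longrightarrow> \<bar>f z - Re (poly p z)\<bar> < e / 2" by simp
    have "integral\<^sup>L \<mu> (\<lambda>z. Re (poly p z)) = integral\<^sup>L \<nu> (\<lambda>z. Re (poly p z))"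
      using moment[OF prob(1) sets(1) S(2)] moment[OF prob(2) sets(2) S(3)] by (simp add: mom')
    then show ?thesis
      using close[OF prob(1) sets(1) S(2) p] close[OF prob(2) sets(2) S(3) p] by linarith
  qed
  then have "\<bar>integral\<^sup>L \<mu> f - integral\<^sup>L \<nu> f\<bar> \<le> 0" by (rule field_le_epsilon) simp
  then show "integral\<^sup>L \<mu> f = integral\<^sup>L \<nu> f" by simp
qed

lemma conj_monomial_real:
  assumes "\<And>z. z \<in> S \<Longrightarrow> Im z = 0"
  shows "\<exists>r. \<forall>z\<in>S. Re (c * z ^ i * cnj z ^ j) = Re (poly r z)"
proof (intro exI[of _ "monom c (i + j)"] ballI)
  fix z assume "z \<in> S"
  then have "cnj z = z" using assms by (simp add: complex_eq_iff)
  then show "Re (c * z ^ i * cnj z ^ j) = Re (poly (monom c (i + j)) z)"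
    by (simp add: poly_monom power_add mult.assoc)
qed

lemma conj_monomial_circle:
  "\<exists>r. \<forall>z\<in>sphere 0 1. Re (c * z ^ i * cnj z ^ j) = Re (poly r z)"
proof (cases "i \<ge> j")
  case True
  show ?thesis
  proof (intro exI[of _ "monom c (i - j)"] ballI)
    fix z :: complex assume "z \<in> sphere 0 1"
    then have z: "z * cnj z = 1" by (simp add: complex_norm_square[symmetric])
    have "z ^ i * cnj z ^ j = z ^ (i - j) * (z * cnj z) ^ j"
      using True by (simp add: power_mult_distrib mult.assoc[symmetric] flip: power_add)
    then show "Re (c * z ^ i * cnj z ^ j) = Re (poly (monom c (i - j)) z)"
      by (simp add: z poly_monom mult.assoc)
  qed
next
  case False
  show ?thesis
  proof (intro exI[of _ "monom (cnj c) (j - i)"] ballI)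
    fix z :: complex assume "z \<in> sphere 0 1"
    then have z: "z * cnj z = 1" by (simp add: complex_norm_square[symmetric])
    have "z ^ i * cnj z ^ j = (z * cnj z) ^ i * cnj z ^ (j - i)"
      using False by (simp add: power_mult_distrib mult.assoc flip: power_add)
    then have "c * z ^ i * cnj z ^ j = cnj (cnj c * z ^ (j - i))"
      by (simp add: z mult.assoc)
    then show "Re (c * z ^ i * cnj z ^ j) = Re (poly (monom (cnj c) (j - i)) z)"
      by (simp only: poly_monom cnj.simps(1))
  qed
qed

lemma limit_properties_unique:
  assumes sets: "sets \<mu> = sets borel" "sets \<nu> = sets borel" and prob: "prob_space \<mu>" "prob_space \<nu>"
    and lp: "limit_properties s \<mu>" "limit_properties s \<nu>"
  shows "\<mu> = \<nu>"
proof -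
  have mom: "integral\<^sup>L \<mu> (\<lambda>z. z ^ k) = integral\<^sup>L \<nu> (\<lambda>z. z ^ k)" if "k \<ge> 1" for k
  proof -
    have "integral\<^sup>L N (\<lambda>z. z ^ k) = exp (complex_of_real s * of_nat k / 2) / of_nat k *
        taylor_coeff (k - 1) (\<lambda>u. (1 + u) ^ k * exp (complex_of_real s * of_nat k * u))"
      if "limit_properties s N" for N
      using that \<open>k \<ge> 1\<close> unfolding limit_properties_def Let_def by blast
    then show ?thesis using lp by simp
  qed
  show ?thesis
  proof (cases "s \<ge> 0")
    case True
    then obtain K L :: "real set" where K: "compact K" "AE z in \<mu>. z \<in> complex_of_real ` K"
      and L: "compact L" "AE z in \<nu>. z \<in> complex_of_real ` L"
      using lp unfolding limit_properties_def by blast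
    define S where "S = complex_of_real ` (K \<union> L)"
    show ?thesis
    proof (rule moments_determine_measure[OF sets prob _ _ _ _ mom])
      show "compact S" unfolding S_def using K L
        by (intro compact_continuous_image continuous_intros compact_Un)
      show "AE z in \<mu>. z \<in> S" "AE z in \<nu>. z \<in> S"
        using K(2) L(2) by (auto simp: S_def elim!: eventually_mono)
      show "\<exists>r. \<forall>z\<in>S. Re (c * z ^ i * cnj z ^ j) = Re (poly r z)" for c i j
        by (rule conj_monomial_real) (auto simp: S_def)
    qed
  next
    case False
    show ?thesis
    proof (rule moments_determine_measure[OF sets prob _ _ _ conj_monomial_circle mom])
      show "AE z in \<mu>. z \<in> sphere 0 1" "AE z in \<nu>. z \<in> sphere 0 1"
        using lp False by (auto simp: limit_properties_def)
    qed auto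
  qed
qed

section \<open>Weak limits and moments\<close>

text \<open>
  Weak convergence handles bounded functions. For unbounded \<phi> the bound B on the second moments makes
  \<phi> uniformly integrable: truncating \<phi> at level i changes its integral by at most B / i.
\<close>
lemma weak_limit_of_integrals:
  fixes \<rho> :: "nat \<Rightarrow> real measure" and \<phi> :: "real \<Rightarrow> real"
  assumes rd: "\<And>n. real_distribution (\<rho> n)" "real_distribution \<sigma>" and conv: "weak_conv_m \<rho> \<sigma>"
    and cont: "continuous_on UNIV \<phi>"
    and sq: "\<And>n. integrable (\<rho> n) (\<lambda>x. (\<phi> x)\<^sup>2)" "\<And>n. integral\<^sup>L (\<rho> n) (\<lambda>x. (\<phi> x)\<^sup>2) \<le> B"
    and lim: "(\<lambda>n. integral\<^sup>L (\<rho> n) \<phi>) \<longlonglongrightarrow> m"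
  shows "integrable \<sigma> \<phi>" and "integral\<^sup>L \<sigma> \<phi> = m"
proof -
  interpret \<sigma>: real_distribution \<sigma> by fact
  interpret \<rho>: real_distribution "\<rho> n" for n by fact
  have meas [measurable]: "\<phi> \<in> borel_measurable borel"
    using cont by (rule borel_measurable_continuous_onI)
  have int_\<phi>: "integrable (\<rho> n) \<phi>" for n
  proof (rule Bochner_Integration.integrable_bound)
    show "integrable (\<rho> n) (\<lambda>x. 1 + (\<phi> x)\<^sup>2)" using sq by simp
    have "\<bar>y\<bar> \<le> 1 + y\<^sup>2" for y :: real
      using zero_le_power2[of "\<bar>y\<bar> - 1"] by (simp add: power2_eq_square algebra_simps abs_mult_self_eq)
    then show "AE x in \<rho> n. norm (\<phi> x) \<le> norm (1 + (\<phi> x)\<^sup>2)" by (simp add: abs_of_nonneg)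
  qed simp
  \<comment> \<open>Integrability: the truncations of |\<phi>| have integrals at most 1 + B, since y is at most 1 + y^2.\<close>
  define g where "g i x = min (real i) \<bar>\<phi> x\<bar>" for i :: nat and x
  have g_cont: "isCont (g i) x" for i x
    unfolding g_def using cont by (auto intro!: continuous_intros simp: continuous_on_eq_continuous_at)
  have g_bdd: "norm (g i x) \<le> real i" for i x by (simp add: g_def)
  have g_meas: "g i \<in> borel_measurable borel" for i
    unfolding g_def by measurable
  have g_int: "integrable \<sigma> (g i)" for i
    by (rule \<sigma>.integrable_const_bound[where B = "real i"]) (use g_bdd g_meas in auto)
  have g_le: "integral\<^sup>L \<sigma> (g i) \<le> 1 + B" for i
  proof (rule LIMSEQ_le_const2)
    show "(\<lambda>n. integral\<^sup>L (\<rho> n) (g i)) \<longlonglongrightarrow> integral\<^sup>L \<sigma> (g i)"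
      by (rule weak_conv_imp_integral_bdd_continuous_conv[OF rd conv g_cont g_bdd])
    have "integral\<^sup>L (\<rho> n) (g i) \<le> integral\<^sup>L (\<rho> n) (\<lambda>x. 1 + (\<phi> x)\<^sup>2)" for n
    proof (rule integral_mono)
      show "integrable (\<rho> n) (g i)"
        by (rule \<rho>.integrable_const_bound[where B = "real i"]) (use g_bdd g_meas in auto)
      show "integrable (\<rho> n) (\<lambda>x. 1 + (\<phi> x)\<^sup>2)" using sq by simp
      fix x
      have "\<bar>y\<bar> \<le> 1 + y\<^sup>2" for y :: real
        using zero_le_power2[of "\<bar>y\<bar> - 1"] by (simp add: power2_eq_square algebra_simps abs_mult_self_eq)
      then show "g i x \<le> 1 + (\<phi> x)\<^sup>2" by (auto simp: g_def min_le_iff_disj)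
    qed
    also have "integral\<^sup>L (\<rho> n) (\<lambda>x. 1 + (\<phi> x)\<^sup>2) \<le> 1 + B" for n
      using sq[of n] by (simp add: \<rho>.prob_space[simplified])
    finally show "\<exists>N. \<forall>n\<ge>N. integral\<^sup>L (\<rho> n) (g i) \<le> 1 + B" by blast
  qed
  have inc: "incseq (\<lambda>i. integral\<^sup>L \<sigma> (g i))"
    by (intro incseq_SucI integral_mono g_int) (auto simp: g_def)
  then obtain L where L: "(\<lambda>i. integral\<^sup>L \<sigma> (g i)) \<longlonglongrightarrow> L"
    using incseq_convergent[OF inc] g_le by blast
  have "integrable \<sigma> (\<lambda>x. \<bar>\<phi> x\<bar>)"
  proof (rule integrable_monotone_convergence[OF g_int _ _ L])
    show "AE x in \<sigma>. mono (\<lambda>i. g i x)" by (auto simp: g_def mono_def)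
    have "(\<lambda>i. g i x) \<longlonglongrightarrow> \<bar>\<phi> x\<bar>" for x
    proof (rule tendsto_eventually)
      show "\<forall>\<^sub>F i in sequentially. g i x = \<bar>\<phi> x\<bar>"
        using eventually_ge_at_top[of "nat \<lceil>\<bar>\<phi> x\<bar>\<rceil>"] by eventually_elim (auto simp: g_def nat_le_iff ceiling_le_iff)
    qed
    then show "AE x in \<sigma>. (\<lambda>i. g i x) \<longlonglongrightarrow> \<bar>\<phi> x\<bar>" by simp
  qed simp
  then show int: "integrable \<sigma> \<phi>" by (subst (asm) integrable_abs_iff) simp_all
  \<comment> \<open>Value of the integral: two-sided truncations and the bound B / i on the error.\<close>
  define h where "h i x = max (- real i) (min (real i) (\<phi> x))" for i :: nat and x
  have h_cont: "isCont (h i) x" for i x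
    unfolding h_def using cont by (auto intro!: continuous_intros simp: continuous_on_eq_continuous_at)
  have h_bdd: "norm (h i x) \<le> real i" for i x by (auto simp: h_def)
  have h_meas: "h i \<in> borel_measurable borel" for i
    unfolding h_def by measurable
  have near: "\<bar>integral\<^sup>L (\<rho> n) (h i) - integral\<^sup>L (\<rho> n) \<phi>\<bar> \<le> B / real i" if "i > 0" for i n
  proof -
    have hi: "integrable (\<rho> n) (h i)"
      by (rule \<rho>.integrable_const_bound[where B = "real i"]) (use h_bdd h_meas in auto)
    have "\<bar>integral\<^sup>L (\<rho> n) (\<lambda>x. h i x - \<phi> x)\<bar> \<le> integral\<^sup>L (\<rho> n) (\<lambda>x. \<bar>h i x - \<phi> x\<bar>)"
      by (rule integral_abs_bound)
    also have "\<dots> \<le> integral\<^sup>L (\<rho> n) (\<lambda>x. (\<phi> x)\<^sup>2 / real i)"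
    proof (rule integral_mono)
      show "integrable (\<rho> n) (\<lambda>x. \<bar>h i x - \<phi> x\<bar>)"
        using hi int_\<phi> by (intro integrable_abs Bochner_Integration.integrable_diff)
      show "integrable (\<rho> n) (\<lambda>x. (\<phi> x)\<^sup>2 / real i)" using sq by simp
      fix x
      have "\<bar>h i x - \<phi> x\<bar> * real i \<le> (\<phi> x)\<^sup>2"
      proof (cases "\<bar>\<phi> x\<bar> \<le> real i")
        case True
        then have "h i x = \<phi> x" by (auto simp: h_def max_def min_def)
        then show ?thesis by simp
      next
        case False
        then have "\<bar>h i x - \<phi> x\<bar> \<le> \<bar>\<phi> x\<bar>" by (auto simp: h_def max_def min_def)
        then have "\<bar>h i x - \<phi> x\<bar> * real i \<le> \<bar>\<phi> x\<bar> * \<bar>\<phi> x\<bar>"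
          using False by (intro mult_mono) auto
        then show ?thesis by (simp add: power2_eq_square)
      qed
      then show "\<bar>h i x - \<phi> x\<bar> \<le> (\<phi> x)\<^sup>2 / real i" using that by (simp add: field_simps)
    qed
    also have "\<dots> \<le> B / real i" using sq(2)[of n] that by (simp add: divide_right_mono)
    finally show ?thesis by (simp add: Bochner_Integration.integral_diff hi int_\<phi>)
  qed
  have near_lim: "\<bar>integral\<^sup>L \<sigma> (h i) - m\<bar> \<le> B / real i" if "i > 0" for i
  proof (rule LIMSEQ_le_const2)
    show "(\<lambda>n. \<bar>integral\<^sup>L (\<rho> n) (h i) - integral\<^sup>L (\<rho> n) \<phi>\<bar>) \<longlonglongrightarrow> \<bar>integral\<^sup>L \<sigma> (h i) - m\<bar>"
      by (intro tendsto_intros lim weak_conv_imp_integral_bdd_continuous_conv[OF rd conv h_cont h_bdd])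
    show "\<exists>N. \<forall>n\<ge>N. \<bar>integral\<^sup>L (\<rho> n) (h i) - integral\<^sup>L (\<rho> n) \<phi>\<bar> \<le> B / real i"
      using near[OF that] by blast
  qed
  have "(\<lambda>i. integral\<^sup>L \<sigma> (h i)) \<longlonglongrightarrow> integral\<^sup>L \<sigma> \<phi>"
  proof (rule integral_dominated_convergence[where w = "\<lambda>x. \<bar>\<phi> x\<bar>"])
    show "h i \<in> borel_measurable \<sigma>" for i using h_meas by simp
    have "(\<lambda>i. h i x) \<longlonglongrightarrow> \<phi> x" for x
    proof (rule tendsto_eventually)
      show "\<forall>\<^sub>F i in sequentially. h i x = \<phi> x"
        using eventually_ge_at_top[of "nat \<lceil>\<bar>\<phi> x\<bar>\<rceil>"] by eventually_elim (auto simp: h_def nat_le_iff ceiling_le_iff)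
    qed
    then show "AE x in \<sigma>. (\<lambda>i. h i x) \<longlonglongrightarrow> \<phi> x" by simp
    show "AE x in \<sigma>. norm (h i x) \<le> \<bar>\<phi> x\<bar>" for i by (auto simp: h_def max_def min_def)
  qed (use int in auto)
  moreover have "(\<lambda>i. integral\<^sup>L \<sigma> (h i)) \<longlonglongrightarrow> m"
  proof (rule Lim_null_comparison[of "\<lambda>i. integral\<^sup>L \<sigma> (h i) - m", THEN LIM_zero_cancel])
    show "\<forall>\<^sub>F i in sequentially. norm (integral\<^sup>L \<sigma> (h i) - m) \<le> B / real i"
      using eventually_gt_at_top[of 0] by eventually_elim (simp add: near_lim)
    show "(\<lambda>i. B / real i) \<longlonglongrightarrow> 0" by (rule lim_const_over_n)
  qed
  ultimately show "integral\<^sup>L \<sigma> \<phi> = m" by (rule LIMSEQ_unique)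
qed

lemma weak_limit_of_integrals_complex:
  fixes \<rho> :: "nat \<Rightarrow> real measure" and \<phi> :: "real \<Rightarrow> complex"
  assumes rd: "\<And>n. real_distribution (\<rho> n)" "real_distribution \<sigma>" and conv: "weak_conv_m \<rho> \<sigma>"
    and cont: "continuous_on UNIV \<phi>"
    and sq: "\<And>n. integrable (\<rho> n) (\<lambda>x. (cmod (\<phi> x))\<^sup>2)" "\<And>n. integral\<^sup>L (\<rho> n) (\<lambda>x. (cmod (\<phi> x))\<^sup>2) \<le> B"
    and int: "\<And>n. integrable (\<rho> n) \<phi>"
    and lim: "(\<lambda>n. integral\<^sup>L (\<rho> n) \<phi>) \<longlonglongrightarrow> m"
  shows "integrable \<sigma> \<phi>" and "integral\<^sup>L \<sigma> \<phi> = m"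
proof -
  interpret \<rho>: real_distribution "\<rho> n" for n by fact
  have [measurable]: "\<phi> \<in> borel_measurable borel"
    using cont by (rule borel_measurable_continuous_onI)
  have part: "integrable (\<rho> n) (\<lambda>x. (\<psi> x)\<^sup>2) \<and> integral\<^sup>L (\<rho> n) (\<lambda>x. (\<psi> x)\<^sup>2) \<le> B"
    if \<psi>: "\<psi> \<in> borel_measurable borel" "\<And>x. \<bar>\<psi> x\<bar> \<le> cmod (\<phi> x)" for \<psi> :: "real \<Rightarrow> real" and n
  proof -
    have le: "(\<psi> x)\<^sup>2 \<le> (cmod (\<phi> x))\<^sup>2" for x
      using power_mono[OF \<psi>(2), of x 2] by simp
    have i: "integrable (\<rho> n) (\<lambda>x. (\<psi> x)\<^sup>2)"
      by (rule Bochner_Integration.integrable_bound[OF sq(1)[of n]]) (use \<psi> le in auto)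
    have "integral\<^sup>L (\<rho> n) (\<lambda>x. (\<psi> x)\<^sup>2) \<le> integral\<^sup>L (\<rho> n) (\<lambda>x. (cmod (\<phi> x))\<^sup>2)"
      by (rule integral_mono[OF i sq(1)]) (rule le)
    then show ?thesis using i sq(2)[of n] by auto
  qed
  have re: "(\<lambda>n. integral\<^sup>L (\<rho> n) (\<lambda>x. Re (\<phi> x))) \<longlonglongrightarrow> Re m"
    and im: "(\<lambda>n. integral\<^sup>L (\<rho> n) (\<lambda>x. Im (\<phi> x))) \<longlonglongrightarrow> Im m"
    using tendsto_Re[OF lim] tendsto_Im[OF lim] int by simp_all
  have r: "integrable \<sigma> (\<lambda>x. Re (\<phi> x))" "integral\<^sup>L \<sigma> (\<lambda>x. Re (\<phi> x)) = Re m"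
    using part[of "\<lambda>x. Re (\<phi> x)"] cont abs_Re_le_cmod
    by (auto intro!: weak_limit_of_integrals[OF rd conv _ _ _ re] continuous_intros)
  have i: "integrable \<sigma> (\<lambda>x. Im (\<phi> x))" "integral\<^sup>L \<sigma> (\<lambda>x. Im (\<phi> x)) = Im m"
    using part[of "\<lambda>x. Im (\<phi> x)"] cont abs_Im_le_cmod
    by (auto intro!: weak_limit_of_integrals[OF rd conv _ _ _ im] continuous_intros)
  have "integrable \<sigma> (\<lambda>x. of_real (Re (\<phi> x)) + \<i> * of_real (Im (\<phi> x)))"
    using r i by (intro Bochner_Integration.integrable_add integrable_mult_right) auto
  then show *: "integrable \<sigma> \<phi>" by (simp add: complex_eq[symmetric])
  show "integral\<^sup>L \<sigma> \<phi> = m"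
    using r i integral_Re[OF *] integral_Im[OF *] by (simp add: complex_eq_iff)
qed

lemma tight_of_bounded_abs_moment:
  fixes \<rho> :: "nat \<Rightarrow> real measure"
  assumes rd: "\<And>n. real_distribution (\<rho> n)"
    and int: "\<And>n. integrable (\<rho> n) (\<lambda>x. x)" "\<And>n. integral\<^sup>L (\<rho> n) (\<lambda>x. \<bar>x\<bar>) \<le> B"
  shows "tight \<rho>"
  unfolding tight_def
proof (intro conjI allI impI rd)
  fix \<epsilon> :: real assume \<epsilon>: "\<epsilon> > 0"
  define a where "a = (\<bar>B\<bar> + 1) / \<epsilon>"
  have a: "a > 0" using \<epsilon> by (simp add: a_def)
  have "measure (\<rho> n) {-a<..a} > 1 - \<epsilon>" for n
  proof -
    interpret real_distribution "\<rho> n" by fact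
    have "measure (\<rho> n) {x \<in> space (\<rho> n). \<bar>x\<bar> \<ge> a} \<le> integral\<^sup>L (\<rho> n) (\<lambda>x. \<bar>x\<bar>) / a"
      using int(1)[of n] a by (intro integral_Markov_inequality_measure[where A = "{}"]) auto
    also have "\<dots> \<le> B / a" using int(2)[of n] a by (simp add: divide_right_mono)
    also have "\<dots> < \<epsilon>"
    proof -
      have "B < \<epsilon> * a" using \<epsilon> by (simp add: a_def)
      then show ?thesis using a by (simp add: field_simps)
    qed
    finally have "measure (\<rho> n) {x. \<bar>x\<bar> \<ge> a} < \<epsilon>" by simp
    moreover have "1 - measure (\<rho> n) {x. \<bar>x\<bar> \<ge> a} = measure (\<rho> n) (- {x. \<bar>x\<bar> \<ge> a})"
      using prob_compl[of "{x. \<bar>x\<bar> \<ge> a}"] by (simp add: Compl_eq_Diff_UNIV)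
    moreover have "measure (\<rho> n) (- {x. \<bar>x\<bar> \<ge> a}) \<le> measure (\<rho> n) {-a<..a}"
      by (intro finite_measure_mono) auto
    ultimately show ?thesis by linarith
  qed
  then show "\<exists>a b. a < b \<and> (\<forall>n. 1 - \<epsilon> < measure (\<rho> n) {a<..b})"
    using a by (intro exI[of _ "-a"] exI[of _ a]) auto
qed

text \<open>
  The bounded continuous function min 1 (dist (z, F)) has integral 0 along the sequence, hence in the
  limit, and it vanishes exactly on F.
\<close>
lemma AE_closed_weak_limit:
  fixes \<mu> :: "'a::metric_space measure"
  assumes "finite_measure \<mu>" "sets \<mu> = sets borel" and conv: "weakly_converges M \<mu>"
    and F: "closed F" "F \<noteq> {}" "\<And>n. AE z in M n. z \<in> F"
  shows "AE z in \<mu>. z \<in> F"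
proof -
  interpret finite_measure \<mu> by fact
  define f where "f z = min 1 (infdist z F)" for z
  have cont: "continuous_on UNIV f" unfolding f_def by (intro continuous_intros)
  have f01: "0 \<le> f z" "f z \<le> 1" for z by (auto simp: f_def infdist_nonneg)
  have bdd: "bounded (range f)" using f01 by (intro boundedI[of _ 1]) auto
  have "integral\<^sup>L (M n) f = 0" for n
    using F(3)[of n] by (intro integral_eq_zero_AE) (auto simp: f_def elim!: eventually_mono)
  then have "integral\<^sup>L \<mu> f = 0"
    using conv cont bdd LIMSEQ_unique[OF _ tendsto_const[of 0]] unfolding weakly_converges_def by fastforce
  moreover have "integrable \<mu> f"
    using borel_measurable_continuous_onI[OF cont] f01 assms(2)
    by (intro integrable_const_bound[where B = 1]) (auto cong: measurable_cong_sets)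
  ultimately have "AE z in \<mu>. f z = 0"
    using integral_nonneg_eq_0_iff_AE[where M = \<mu> and f = f] f01 by auto
  then show ?thesis
  proof eventually_elim
    case (elim z)
    then have "infdist z F = 0" by (auto simp: f_def min_def split: if_splits)
    then show ?case using in_closed_iff_infdist_zero[OF F(1,2)] by blast
  qed
qed

text \<open>
  By the Markov inequality for z^k, the mass of the set where |z| \<ge> A + 1 is at most (A / (A + 1))^k
  for every k \<ge> 1.
\<close>
lemma AE_norm_le_of_moments:
  fixes \<mu> :: "complex measure"
  assumes prob: "prob_space \<mu>" and sets: "sets \<mu> = sets borel"
    and pos: "AE z in \<mu>. Im z = 0 \<and> Re z \<ge> 0"
    and int: "\<And>k. k \<ge> 1 \<Longrightarrow> integrable \<mu> (\<lambda>z. z ^ k)"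
    and mom: "\<And>k. k \<ge> 1 \<Longrightarrow> norm (integral\<^sup>L \<mu> (\<lambda>z. z ^ k)) \<le> A ^ k" and A: "A \<ge> 0"
  shows "AE z in \<mu>. cmod z < A + 1"
proof -
  interpret prob_space \<mu> by fact
  have [measurable]: "cmod \<in> borel_measurable \<mu>"
    by (simp add: measurable_cong_sets[OF sets refl])
  have sp: "space \<mu> = UNIV" using sets_eq_imp_space_eq[OF sets] by simp
  define U where "U = {z. cmod z \<ge> A + 1}"
  have bound: "measure \<mu> U \<le> (A / (A + 1)) ^ k" if "k \<ge> 1" for k
  proof -
    have "U = {z \<in> space \<mu>. cmod z ^ k \<ge> (A + 1) ^ k}"
      using that A by (auto simp: U_def sp power_mono_iff)
    then have "measure \<mu> U = measure \<mu> {z \<in> space \<mu>. cmod z ^ k \<ge> (A + 1) ^ k}" by simp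
    also have "\<dots> \<le> integral\<^sup>L \<mu> (\<lambda>z. cmod z ^ k) / (A + 1) ^ k"
      using int[OF that] A
      by (intro integral_Markov_inequality_measure[where A = "{}"]) (auto simp: norm_power[symmetric])
    also have "integral\<^sup>L \<mu> (\<lambda>z. cmod z ^ k) = integral\<^sup>L \<mu> (\<lambda>z. Re (z ^ k))"
    proof (rule integral_cong_AE)
      show "AE z in \<mu>. cmod z ^ k = Re (z ^ k)"
        using pos
      proof eventually_elim
        case (elim z)
        then have "z = of_real (Re z)" "cmod z = Re z" by (auto simp: complex_eq_iff cmod_eq_Re)
        then show ?case by (metis Re_complex_of_real of_real_power)
      qed
    qed (use int[OF that] in auto)
    also have "\<dots> = Re (integral\<^sup>L \<mu> (\<lambda>z. z ^ k))"
      by (intro integral_Re int that)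
    also have "\<dots> \<le> A ^ k"
      using mom[OF that] complex_Re_le_cmod order_trans by blast
    finally show ?thesis using A by (simp add: power_divide divide_right_mono)
  qed
  have "(\<lambda>k. (A / (A + 1)) ^ k) \<longlonglongrightarrow> 0" using A by (intro LIMSEQ_realpow_zero) auto
  then have "measure \<mu> U \<le> 0"
    by (rule LIMSEQ_le_const) (use bound in blast)
  then have "measure \<mu> U = 0" by (simp add: measure_le_0_iff)
  moreover have "U \<in> sets \<mu>" unfolding U_def sets
    by (intro borel_closed closed_Collect_le continuous_intros)
  ultimately have "AE z in \<mu>. z \<notin> U" by (intro AE_not_in) (auto simp: null_sets_def emeasure_eq_measure)
  then show ?thesis by (auto simp: U_def not_le)
qed

lemma tendsto_of_subsubsequences:
  fixes x :: "nat \<Rightarrow> 'a::metric_space"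
  assumes "\<And>r :: nat \<Rightarrow> nat. strict_mono r \<Longrightarrow> \<exists>q :: nat \<Rightarrow> nat. strict_mono q \<and> (\<lambda>n. x (r (q n))) \<longlonglongrightarrow> L"
  shows "x \<longlonglongrightarrow> L"
proof (rule ccontr)
  assume "\<not> x \<longlonglongrightarrow> L"
  then obtain e where e: "e > 0" "\<not> eventually (\<lambda>n. dist (x n) L < e) sequentially"
    unfolding tendsto_iff by blast
  from not_eventually_sequentiallyD[OF e(2)] obtain r :: "nat \<Rightarrow> nat"
    where r: "strict_mono r" "\<And>n. \<not> dist (x (r n)) L < e" by blast
  obtain q where "(\<lambda>n. x (r (q n))) \<longlonglongrightarrow> L" using assms[OF r(1)] by blast
  from tendstoD[OF this e(1)] show False using r(2) by simp
qed

section \<open>Convergence of the zero distributions\<close>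

lemma taylor_coeff_eq:
  "taylor_coeff m (\<lambda>u. (1 + u) ^ k * exp (t * u)) = fps_nth ((1 + fps_X) ^ k * fps_exp t) m"
proof -
  have "(\<lambda>u::complex. (1 + u) ^ k * exp (t * u)) has_fps_expansion (1 + fps_X) ^ k * fps_exp t"
    by (intro fps_expansion_intros)
  then have "fps_nth ((1 + fps_X) ^ k * fps_exp t) m =
      (deriv ^^ m) (\<lambda>u. (1 + u) ^ k * exp (t * u)) 0 / fact m"
    by (rule fps_nth_fps_expansion)
  then show ?thesis by (simp add: fps_expansion_def)
qed

lemma laguerre_eq:
  assumes "k \<ge> 1"
  shows "laguerre (k - 1) 1 (- t) = (\<Sum>j=0..k-1. of_nat (k choose (j + 1)) * t ^ j / fact j :: complex)"
  unfolding laguerre_def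
proof (intro sum.cong refl)
  fix j assume "j \<in> {0..k-1}"
  then have "k choose (k - 1 - j) = k choose (j + 1)"
    using assms by (subst binomial_symmetric) (auto intro!: arg_cong[where f = "binomial k"])
  moreover have "of_nat (k - 1) + 1 = (of_nat k :: complex)" using assms by (cases k) auto
  ultimately show "(of_nat (k - 1) + 1 gchoose (k - 1 - j)) * (- (- t)) ^ j / fact j =
     (of_nat (k choose (j + 1)) * t ^ j / fact j :: complex)"
    by (simp only: binomial_gbinomial[symmetric] minus_minus)
qed

text \<open>
  The sequence of the theorem. At n = 0 it is not a probability measure, so the sequential arguments
  below use Suc n.
\<close>
definition hermite_distr :: "real \<Rightarrow> nat \<Rightarrow> complex measure" where
  "hermite_distr s n = zero_distr n (mult_hermite n (complex_of_real s / of_nat n))"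

lemma hermite_roots:
  assumes "n > 0"
  shows "s \<ge> 0 \<Longrightarrow> roots_in pos_reals (mult_hermite n (complex_of_real s / of_nat n))"
    and "s \<le> 0 \<Longrightarrow> roots_in unit_circle (mult_hermite n (complex_of_real s / of_nat n))"
  using mult_hermite_pos_roots[of "s / real n" n] mult_hermite_circle_roots[of "s / real n" n] assms
  by (simp_all add: divide_nonpos_nonneg)

lemma hermite_roots_mset:
  assumes n: "n > 0" and z: "z \<in># proots (mult_hermite n (complex_of_real s / of_nat n))"
  shows "s \<ge> 0 \<Longrightarrow> \<exists>x>0. z = of_real x" and "s \<le> 0 \<Longrightarrow> cmod z = 1"
proof -
  have "poly (mult_hermite n (complex_of_real s / of_nat n)) z = 0"
    using z by (cases "mult_hermite n (complex_of_real s / of_nat n) = 0") auto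
  then show "s \<ge> 0 \<Longrightarrow> \<exists>x>0. z = of_real x" and "s \<le> 0 \<Longrightarrow> cmod z = 1"
    using hermite_roots[OF n, of s] by (auto simp: roots_in_def)
qed

lemma hermite_distr_props:
  assumes "n > 0"
  shows "sets (hermite_distr s n) = sets borel" "prob_space (hermite_distr s n)"
  unfolding hermite_distr_def
  by (rule sets_zero_distr, rule prob_space_zero_distr[OF degree_mult_hermite assms])

lemma
  fixes f :: "complex \<Rightarrow> 'b::{real_normed_field,banach,second_countable_topology}"
  assumes "n > 0" "f \<in> borel_measurable borel"
  shows integrable_hermite_distr: "integrable (hermite_distr s n) f"
    and integral_hermite_distr: "integral\<^sup>L (hermite_distr s n) f =
      (\<Sum>z\<in>#proots (mult_hermite n (complex_of_real s / of_nat n)). f z) / of_nat n"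
  unfolding hermite_distr_def
  by (rule integrable_zero_distr[OF degree_mult_hermite assms],
      rule integral_zero_distr[OF degree_mult_hermite assms])

lemma abs_ln_le: "x > 0 \<Longrightarrow> \<bar>ln x\<bar> \<le> x + 1 / x" for x :: real
proof -
  assume x: "x > 0"
  have "1 / x > 0" "ln x \<le> x - 1" "- ln x \<le> 1 / x - 1"
    using x ln_le_minus_one[of x] ln_le_minus_one[of "1 / x"] by (simp_all add: ln_div)
  then show ?thesis using x by linarith
qed

text \<open>
  Zeros on the positive half-line and on the circle are both of the form exp (\<omega> r) with r real, for
  \<omega> = 1 and \<omega> = i. This makes the theory of weak convergence on the real line applicable, and
  inversion becomes r to -r in both cases. The bound on r is used for tightness.
\<close>
lemma exponential_chart:
  obtains \<omega> :: complex where
    "\<And>n z. n > 0 \<Longrightarrow> z \<in># proots (mult_hermite n (complex_of_real s / of_nat n)) \<Longrightarrow>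
      exp (\<omega> * of_real (Re (Ln z / \<omega>))) = z \<and> \<bar>Re (Ln z / \<omega>)\<bar> \<le> cmod z + cmod (1 / z) + pi"
proof (cases "s \<ge> 0")
  case True
  show ?thesis
  proof (rule that[of 1])
    fix n :: nat and z
    assume "n > 0" "z \<in># proots (mult_hermite n (complex_of_real s / of_nat n))"
    then obtain x where x: "z = of_real x" "x > 0" using hermite_roots_mset(1) True by blast
    have "Ln z = of_real (ln x)" using x by (simp add: Ln_of_real)
    then show "exp (1 * of_real (Re (Ln z / 1))) = z \<and> \<bar>Re (Ln z / 1)\<bar> \<le> cmod z + cmod (1 / z) + pi"
      using x abs_ln_le[of x] pi_ge_zero by (auto simp: exp_of_real norm_divide intro: order_trans)
  qed
next
  case False
  show ?thesis
  proof (rule that[of \<i>])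
    fix n :: nat and z
    assume "n > 0" "z \<in># proots (mult_hermite n (complex_of_real s / of_nat n))"
    then have z1: "cmod z = 1" using hermite_roots_mset(2) False by auto
    then have z0: "z \<noteq> 0" by auto
    have "Re (Ln z) = 0" using z0 z1 by simp
    then have *: "\<i> * of_real (Im (Ln z)) = Ln z" by (simp add: complex_eq_iff)
    have "\<bar>Im (Ln z)\<bar> \<le> pi" using mpi_less_Im_Ln[OF z0] Im_Ln_le_pi[OF z0] by (simp add: abs_le_iff)
    moreover have "exp (\<i> * of_real (Im (Ln z))) = z" unfolding * using z0 by simp
    moreover have "Re (Ln z / \<i>) = Im (Ln z)" by (simp add: Re_divide)
    ultimately show "exp (\<i> * of_real (Re (Ln z / \<i>))) = z \<and> \<bar>Re (Ln z / \<i>)\<bar> \<le> cmod z + cmod (1 / z) + pi"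
      using z1 by (simp add: norm_divide)
  qed
qed

text \<open>
  For s \<ge> 0 the zeros are positive, so absolute moments are moments and converge. For s < 0 all
  zeros have modulus 1.
\<close>
lemma abs_moment_bounded:
  "\<exists>B. \<forall>n>0. (\<Sum>z\<in>#proots (mult_hermite n (complex_of_real s / of_nat n)). cmod z ^ k) / real n \<le> B"
proof (cases "s \<ge> 0 \<and> k > 0")
  case True
  let ?m = "\<lambda>n. (\<Sum>z\<in>#proots (mult_hermite n (complex_of_real s / of_nat n)). z ^ k) / of_nat n"
  have "Bseq ?m"
    using power_sum_tendsto[of k s] True by (intro convergent_imp_Bseq convergentI) auto
  then obtain B where B: "\<And>n. cmod (?m n) \<le> B" by (auto simp: Bseq_def)
  have "(\<Sum>z\<in>#proots (mult_hermite n (complex_of_real s / of_nat n)). cmod z ^ k) / real n \<le> B" if n: "n > 0" for n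
  proof -
    let ?A = "proots (mult_hermite n (complex_of_real s / of_nat n))"
    have "(\<Sum>z\<in>#?A. cmod z ^ k) = (\<Sum>z\<in>#?A. Re (z ^ k))"
    proof (intro arg_cong[where f = sum_mset] image_mset_cong)
      fix z assume "z \<in># ?A"
      then obtain x where "z = of_real x" "x > 0" using hermite_roots_mset(1)[OF n] True by blast
      then show "cmod z ^ k = Re (z ^ k)" by (simp flip: of_real_power)
    qed
    then have "(\<Sum>z\<in>#?A. cmod z ^ k) / real n = Re (?m n)"
      by (simp add: Re_sum_mset Re_divide_of_nat)
    also have "\<dots> \<le> B" using B[of n] complex_Re_le_cmod order_trans by blast
    finally show ?thesis .
  qed
  then show ?thesis by blast
next
  case False
  have "(\<Sum>z\<in>#proots (mult_hermite n (complex_of_real s / of_nat n)). cmod z ^ k) / real n \<le> 1" if n: "n > 0" for n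
  proof -
    let ?A = "proots (mult_hermite n (complex_of_real s / of_nat n))"
    have "(\<Sum>z\<in>#?A. cmod z ^ k) = (\<Sum>z\<in>#?A. 1)"
    proof (intro arg_cong[where f = sum_mset] image_mset_cong)
      fix z assume z: "z \<in># ?A"
      show "cmod z ^ k = 1"
      proof (cases "k = 0")
        case k: False
        then have "cmod z = 1" using False hermite_roots_mset(2)[OF n z] by auto
        then show ?thesis by simp
      qed simp
    qed
    then show ?thesis using n by (simp add: size_proots_complex degree_mult_hermite)
  qed
  then show ?thesis by blast
qed

text \<open>
  The exponents r of the zeros exp (\<omega> r) form a tight sequence of real distributions, because
  |r| is at most |z| + |1/z| + \<pi>. The image \<mu> of a weak limit of these distributions under
  r to exp (\<omega> r) inherits the moments by boundedness of the second absolute moments, and the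
  inversion symmetry since r to -r is continuous, whereas z to 1/z is not continuous at 0.
\<close>
lemma hermite_subsequence_limit:
  fixes r :: "nat \<Rightarrow> nat"
  assumes r: "strict_mono r"
  shows "\<exists>(q :: nat \<Rightarrow> nat) \<mu>. strict_mono q \<and> sets \<mu> = sets borel \<and> prob_space \<mu> \<and>
    weakly_converges (\<lambda>n. hermite_distr s (Suc (r (q n)))) \<mu> \<and>
    distr \<mu> borel (\<lambda>z. 1 / z) = \<mu> \<and> (AE z in \<mu>. z \<noteq> 0) \<and>
    (\<forall>k\<ge>1. integrable \<mu> (\<lambda>z. z ^ k) \<and> integral\<^sup>L \<mu> (\<lambda>z. z ^ k) = limit_moment s k)"
proof -
  obtain \<omega> where \<omega>: "\<And>n z. n > 0 \<Longrightarrow> z \<in># proots (mult_hermite n (complex_of_real s / of_nat n)) \<Longrightarrow>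
      exp (\<omega> * of_real (Re (Ln z / \<omega>))) = z \<and> \<bar>Re (Ln z / \<omega>)\<bar> \<le> cmod z + cmod (1 / z) + pi"
    using exponential_chart[of s] by blast
  define h where "h z = Re (Ln z / \<omega>)" for z
  define g where "g x = exp (\<omega> * of_real x)" for x :: real
  define R where "R n = proots (mult_hermite n (complex_of_real s / of_nat n))" for n
  have gh: "g (h z) = z" and h_le: "\<bar>h z\<bar> \<le> cmod z + cmod (1 / z) + pi" if "n > 0" "z \<in># R n" for n z
    using \<omega>[of n z] that by (auto simp: g_def h_def R_def)
  have h_meas [measurable]: "h \<in> borel_measurable borel" unfolding h_def by measurable
  have g_cont: "continuous_on UNIV g" unfolding g_def by (intro continuous_intros)
  then have g_meas [measurable]: "g \<in> borel_measurable borel" by (rule borel_measurable_continuous_onI)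
  define X where "X n = hermite_distr s (Suc n)" for n
  have X: "sets (X n) = sets borel" "prob_space (X n)" for n
    using hermite_distr_props[of "Suc n"] by (simp_all add: X_def)
  have X_meas: "borel_measurable (X n) = borel_measurable borel" for n :: nat
    by (rule measurable_cong_sets[OF X(1) refl])
  define \<rho> where "\<rho> n = distr (X n) borel h" for n
  have rd: "real_distribution (\<rho> n)" for n
  proof -
    interpret prob_space "X n" by (rule X)
    show ?thesis unfolding \<rho>_def by (rule real_distribution_distr) (simp add: X_meas)
  qed
  have \<rho>_int: "integrable (\<rho> n) F" "integral\<^sup>L (\<rho> n) F = (\<Sum>z\<in>#R (Suc n). F (h z)) / of_nat (Suc n)"
    if [measurable]: "F \<in> borel_measurable borel" for n
      and F :: "real \<Rightarrow> 'b::{real_normed_field,banach,second_countable_topology}"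
  proof -
    have Fh: "(\<lambda>z. F (h z)) \<in> borel_measurable borel" by measurable
    have hX: "h \<in> borel_measurable (X n)" unfolding X_meas by (rule h_meas)
    show "integrable (\<rho> n) F"
      unfolding \<rho>_def integrable_distr_eq[OF hX that]
      unfolding X_def
      by (rule integrable_hermite_distr[OF zero_less_Suc Fh])
    show "integral\<^sup>L (\<rho> n) F = (\<Sum>z\<in>#R (Suc n). F (h z)) / of_nat (Suc n)"
      unfolding \<rho>_def integral_distr[OF hX that]
      unfolding X_def R_def
      by (rule integral_hermite_distr[OF zero_less_Suc Fh])
  qed
  have \<rho>_g: "integral\<^sup>L (\<rho> n) (\<lambda>x. F (g x)) = (\<Sum>z\<in>#R (Suc n). F z) / of_nat (Suc n)"
    if [measurable]: "F \<in> borel_measurable borel" for n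
      and F :: "complex \<Rightarrow> 'b::{real_normed_field,banach,second_countable_topology}"
  proof -
    have "(\<Sum>z\<in>#R (Suc n). F (g (h z))) = (\<Sum>z\<in>#R (Suc n). F z)"
      by (intro arg_cong[where f = sum_mset] image_mset_cong) (simp add: gh[OF zero_less_Suc])
    moreover have "(\<lambda>x. F (g x)) \<in> borel_measurable borel" by measurable
    ultimately show ?thesis by (simp only: \<rho>_int(2))
  qed
  have R_inv: "image_mset (\<lambda>z. 1 / z) (R n) = R n" for n
    unfolding R_def by (rule proots_mult_hermite_inverse)
  have R_size: "size (R n) = n" for n
    by (simp add: R_def size_proots_complex degree_mult_hermite)
  obtain B where B: "\<And>n. n > 0 \<Longrightarrow> (\<Sum>z\<in>#R n. cmod z) / real n \<le> B"
    using abs_moment_bounded[where s = s and k = 1] unfolding R_def power_one_right by blast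
  have "tight \<rho>"
  proof (rule tight_of_bounded_abs_moment[OF rd])
    show "integrable (\<rho> n) (\<lambda>x. x)" for n by (rule \<rho>_int) simp
    fix n
    have "(\<Sum>z\<in>#R (Suc n). \<bar>h z\<bar>) \<le> (\<Sum>z\<in>#R (Suc n). cmod z + cmod (1 / z) + pi)"
      by (rule sum_mset_mono) (use h_le in auto)
    also have "\<dots> = (\<Sum>z\<in>#R (Suc n). cmod z) + (\<Sum>z\<in>#image_mset (\<lambda>z. 1 / z) (R (Suc n)). cmod z) + real (Suc n) * pi"
      by (simp add: sum_mset.distrib R_size image_mset.compositionality o_def del: of_nat_Suc)
    also have "\<dots> = 2 * (\<Sum>z\<in>#R (Suc n). cmod z) + real (Suc n) * pi"
      by (simp only: R_inv)
    finally have "integral\<^sup>L (\<rho> n) (\<lambda>x. \<bar>x\<bar>) \<le>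
        (2 * (\<Sum>z\<in>#R (Suc n). cmod z) + real (Suc n) * pi) / real (Suc n)"
      by (subst \<rho>_int(2)) (auto intro!: divide_right_mono simp del: of_nat_Suc)
    also have "\<dots> = 2 * ((\<Sum>z\<in>#R (Suc n). cmod z) / real (Suc n)) + pi"
      by (simp add: field_simps del: of_nat_Suc)
    also have "\<dots> \<le> 2 * B + pi" using B[of "Suc n"] by (intro add_mono mult_left_mono) auto
    finally show "integral\<^sup>L (\<rho> n) (\<lambda>x. \<bar>x\<bar>) \<le> 2 * B + pi" .
  qed
  from tight_imp_convergent_subsubsequence[OF this r] obtain q \<sigma> where q: "strict_mono q"
    and \<sigma>: "real_distribution \<sigma>" and conv: "weak_conv_m (\<rho> \<circ> r \<circ> q) \<sigma>" by metis
  interpret \<sigma>: real_distribution \<sigma> by (rule \<sigma>)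
  define t where "t n = r (q n)" for n
  have t: "filterlim t at_top sequentially"
    unfolding t_def by (rule filterlim_subseq) (use r q in \<open>simp add: strict_mono_def\<close>)
  have conv: "weak_conv_m (\<lambda>n. \<rho> (t n)) \<sigma>" using conv by (simp add: t_def[abs_def] o_def)
  define \<mu> where "\<mu> = distr \<sigma> borel g"
  have g\<sigma>: "g \<in> measurable \<sigma> borel" by simp
  have \<mu>_sets: "sets \<mu> = sets borel" and \<mu>_prob: "prob_space \<mu>"
    unfolding \<mu>_def by (auto intro!: \<sigma>.prob_space_distr g\<sigma>)
  have lim_cb: "(\<lambda>n. integral\<^sup>L (\<rho> (t n)) (\<lambda>x. f x)) \<longlonglongrightarrow> integral\<^sup>L \<sigma> f"
    if f: "continuous_on UNIV f" "bounded (range f)" for f :: "real \<Rightarrow> real"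
  proof -
    obtain C where "\<And>x. norm (f x) \<le> C" using f(2) by (auto simp: bounded_iff)
    then show ?thesis
      using weak_conv_imp_integral_bdd_continuous_conv[OF rd \<sigma> conv, of f C] f(1)
      by (simp add: continuous_on_eq_continuous_at)
  qed
  have fg: "continuous_on UNIV (\<lambda>x. f (g x))" "bounded (range (\<lambda>x. f (g x)))"
    if "continuous_on UNIV f" "bounded (range f)" for f :: "complex \<Rightarrow> real"
    using that g_cont by (auto intro: continuous_on_compose2 bounded_subset)
  have X_int: "integral\<^sup>L (X n) f = (\<Sum>z\<in>#R (Suc n). f z) / real (Suc n)"
    if "continuous_on UNIV f" for f :: "complex \<Rightarrow> real" and n
    unfolding X_def R_def using integral_hermite_distr[OF _ borel_measurable_continuous_onI[OF that], of "Suc n" s] by simp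
  have weak: "weakly_converges (\<lambda>n. X (t n)) \<mu>"
    unfolding weakly_converges_def
  proof (intro allI impI, elim conjE)
    fix f :: "complex \<Rightarrow> real" assume f: "continuous_on UNIV f" "bounded (range f)"
    note [measurable] = borel_measurable_continuous_onI[OF f(1)]
    have "integral\<^sup>L \<mu> f = integral\<^sup>L \<sigma> (\<lambda>x. f (g x))"
      unfolding \<mu>_def by (subst integral_distr) auto
    moreover have "integral\<^sup>L (X n) f = integral\<^sup>L (\<rho> n) (\<lambda>x. f (g x))" for n
      by (simp add: \<rho>_g X_int f)
    ultimately show "(\<lambda>n. integral\<^sup>L (X (t n)) f) \<longlonglongrightarrow> integral\<^sup>L \<mu> f"
      using lim_cb[OF fg[OF f]] by simp
  qed
  have inv_meas [measurable]: "(\<lambda>z::complex. 1 / z) \<in> borel_measurable borel" by measurable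
  have inv: "distr \<mu> borel (\<lambda>z. 1 / z) = \<mu>"
  proof (rule measure_eqI_continuous_bounded)
    have inv\<mu>: "(\<lambda>z. 1 / z) \<in> measurable \<mu> borel"
      using inv_meas measurable_cong_sets[OF \<mu>_sets refl] by blast
    show "finite_measure (distr \<mu> borel (\<lambda>z. 1 / z))" "finite_measure \<mu>"
      using prob_space.prob_space_distr[OF \<mu>_prob inv\<mu>] \<mu>_prob by (auto intro: prob_space.finite_measure)
    fix f :: "complex \<Rightarrow> real" assume f: "continuous_on UNIV f" "bounded (range f)"
    have fm [measurable]: "f \<in> borel_measurable borel" by (rule borel_measurable_continuous_onI[OF f(1)])
    have f1m: "(\<lambda>z. f (1 / z)) \<in> borel_measurable borel" by measurable
    have gm: "g (- x) = 1 / g x" for x by (simp add: g_def exp_minus inverse_eq_divide)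
    have "integral\<^sup>L (distr \<mu> borel (\<lambda>z. 1 / z)) f = integral\<^sup>L \<sigma> (\<lambda>x. f (g (- x)))"
      unfolding \<mu>_def gm by (subst integral_distr, simp, simp)+ simp
    moreover have "(\<lambda>n. integral\<^sup>L (\<rho> (t n)) (\<lambda>x. f (g (- x)))) \<longlonglongrightarrow> integral\<^sup>L \<sigma> (\<lambda>x. f (g (- x)))"
    proof (rule lim_cb)
      show "continuous_on UNIV (\<lambda>x. f (g (- x)))"
        by (rule continuous_on_compose2[OF fg(1)[OF f]]) (auto intro: continuous_intros)
      show "bounded (range (\<lambda>x. f (g (- x))))" using f(2) by (auto intro: bounded_subset)
    qed
    moreover have "integral\<^sup>L (\<rho> n) (\<lambda>x. f (g (- x))) = integral\<^sup>L (\<rho> n) (\<lambda>x. f (g x))" for n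
    proof -
      have "integral\<^sup>L (\<rho> n) (\<lambda>x. f (g (- x))) = (\<Sum>z\<in>#image_mset (\<lambda>z. 1 / z) (R (Suc n)). f z) / real (Suc n)"
        unfolding gm \<rho>_g[OF f1m] by (simp add: image_mset.compositionality o_def)
      also have "\<dots> = integral\<^sup>L (\<rho> n) (\<lambda>x. f (g x))"
        unfolding R_inv \<rho>_g[OF fm] by simp
      finally show ?thesis .
    qed
    moreover have "(\<lambda>n. integral\<^sup>L (\<rho> (t n)) (\<lambda>x. f (g x))) \<longlonglongrightarrow> integral\<^sup>L \<sigma> (\<lambda>x. f (g x))"
      by (rule lim_cb[OF fg[OF f]])
    moreover have "integral\<^sup>L \<mu> f = integral\<^sup>L \<sigma> (\<lambda>x. f (g x))"
      unfolding \<mu>_def by (subst integral_distr) auto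
    ultimately show "integral\<^sup>L (distr \<mu> borel (\<lambda>z. 1 / z)) f = integral\<^sup>L \<mu> f"
      by (simp add: LIMSEQ_unique)
  qed (simp_all add: \<mu>_sets)
  have nz: "AE z in \<mu>. z \<noteq> 0"
    unfolding \<mu>_def by (subst AE_distr_iff) (auto simp: g_def)
  have mom: "integrable \<mu> (\<lambda>z. z ^ k) \<and> integral\<^sup>L \<mu> (\<lambda>z. z ^ k) = limit_moment s k" if k: "k \<ge> 1" for k
  proof -
    obtain B where B: "\<And>n. n > 0 \<Longrightarrow> (\<Sum>z\<in>#R n. cmod z ^ (2 * k)) / real n \<le> B"
      using abs_moment_bounded[where s = s and k = "2 * k"] unfolding R_def by blast
    have cont: "continuous_on UNIV (\<lambda>x. g x ^ k)" by (intro continuous_intros g_cont)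
    have int: "integrable (\<rho> (t n)) (\<lambda>x. (cmod (g x ^ k))\<^sup>2)" "integrable (\<rho> (t n)) (\<lambda>x. g x ^ k)" for n
      by (rule \<rho>_int; measurable)+
    have sq: "integral\<^sup>L (\<rho> (t n)) (\<lambda>x. (cmod (g x ^ k))\<^sup>2) \<le> B" for n
    proof -
      have "integral\<^sup>L (\<rho> (t n)) (\<lambda>x. (cmod (g x ^ k))\<^sup>2) =
          (\<Sum>z\<in>#R (Suc (t n)). (cmod (z ^ k))\<^sup>2) / of_nat (Suc (t n))"
        by (rule \<rho>_g) measurable
      also have "\<dots> \<le> B"
        using B[of "Suc (t n)"] by (simp add: norm_power mult.commute flip: power_mult)
      finally show ?thesis .
    qed
    have "(\<lambda>n. (\<Sum>z\<in>#R (Suc (t n)). z ^ k) / of_nat (Suc (t n))) \<longlonglongrightarrow> limit_moment s k"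
      unfolding R_def using filterlim_compose[OF LIMSEQ_Suc[OF power_sum_tendsto[of k s]] t] k by simp
    moreover have "integral\<^sup>L (\<rho> (t n)) (\<lambda>x. g x ^ k) =
        (\<Sum>z\<in>#R (Suc (t n)). z ^ k) / of_nat (Suc (t n))" for n
      by (rule \<rho>_g) measurable
    ultimately have lim: "(\<lambda>n. integral\<^sup>L (\<rho> (t n)) (\<lambda>x. g x ^ k)) \<longlonglongrightarrow> limit_moment s k"
      by simp
    have zk: "(\<lambda>z::complex. z ^ k) \<in> borel_measurable borel" by measurable
    show ?thesis
      unfolding \<mu>_def integrable_distr_eq[OF g\<sigma> zk] integral_distr[OF g\<sigma> zk]
      using weak_limit_of_integrals_complex[OF rd \<sigma> conv cont int(1) sq int(2) lim] by blast
  qed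
  show ?thesis
    using q \<mu>_sets \<mu>_prob weak inv nz mom unfolding X_def t_def
    by (intro exI[of _ q] exI[of _ \<mu>]) simp
qed

text \<open>
  Closed conditions on the zeros carry over to the limit. Boundedness of the support from above comes
  from the growth of the moments; invariance under inversion then bounds it away from 0.
\<close>
lemma limit_properties_of_limit:
  assumes \<mu>: "sets \<mu> = sets borel" "prob_space \<mu>"
    and weak: "weakly_converges (\<lambda>n. hermite_distr s (Suc (t n))) \<mu>"
    and inv: "distr \<mu> borel (\<lambda>z. 1 / z) = \<mu>" and nz: "AE z in \<mu>. z \<noteq> 0"
    and mom: "\<And>k. k \<ge> 1 \<Longrightarrow> integrable \<mu> (\<lambda>z. z ^ k) \<and> integral\<^sup>L \<mu> (\<lambda>z. z ^ k) = limit_moment s k"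
  shows "limit_properties s \<mu>"
proof -
  interpret prob_space \<mu> by fact
  have roots_AE: "AE z in hermite_distr s (Suc n). z \<in> F"
    if "roots_in S (mult_hermite (Suc n) (complex_of_real s / of_nat (Suc n)))" "S \<subseteq> F" for S F n
    unfolding hermite_distr_def using that
    by (intro AE_zero_distr degree_mult_hermite) (auto simp: roots_in_def)
  have circle: "AE z in \<mu>. cmod z = 1" if "s \<le> 0"
  proof -
    have "AE z in \<mu>. z \<in> sphere 0 1"
    proof (rule AE_closed_weak_limit[OF finite_measure_axioms \<mu>(1) weak])
      show "AE z in hermite_distr s (Suc (t n)). z \<in> sphere 0 1" for n
        by (rule roots_AE[OF hermite_roots(2)]) (use that in auto)
    qed auto
    then show ?thesis by simp
  qed
  have compact_supp: "\<exists>K :: real set. compact K \<and> K \<subseteq> {0<..} \<and> (AE z in \<mu>. z \<in> complex_of_real ` K)"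
    if s: "s \<ge> 0"
  proof -
    have "AE z in \<mu>. z \<in> {z. Im z = 0 \<and> Re z \<ge> 0}"
    proof (rule AE_closed_weak_limit[OF finite_measure_axioms \<mu>(1) weak])
      show "closed {z. Im z = 0 \<and> Re z \<ge> 0}"
        by (intro closed_Collect_conj closed_Collect_eq closed_Collect_le continuous_intros)
      show "{z. Im z = 0 \<and> Re z \<ge> 0} \<noteq> {}" by (auto intro!: exI[of _ 0])
      show "AE z in hermite_distr s (Suc (t n)). z \<in> {z. Im z = 0 \<and> Re z \<ge> 0}" for n
        by (rule roots_AE[OF hermite_roots(1)]) (use s in auto)
    qed
    then have pos: "AE z in \<mu>. Im z = 0 \<and> Re z \<ge> 0" by simp
    define C where "C = 2 * exp (3 / 2 * s) + 1"
    have C: "C > 0" by (simp add: C_def add_pos_pos)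
    have le: "AE z in \<mu>. cmod z < C"
      unfolding C_def
      by (rule AE_norm_le_of_moments[OF \<mu>(2,1) pos]) (use mom norm_limit_moment_le[OF _ s] in auto)
    have inv\<mu>: "(\<lambda>z. 1 / z) \<in> measurable \<mu> borel"
      unfolding measurable_cong_sets[OF \<mu>(1) refl] by measurable
    have ballC: "{z :: complex. cmod z < C} \<in> sets borel"
      by (intro borel_open open_Collect_less continuous_intros)
    have "AE z in distr \<mu> borel (\<lambda>z. 1 / z). cmod z < C" unfolding inv by (rule le)
    then have ge: "AE z in \<mu>. cmod (1 / z) < C"
      by (subst (asm) AE_distr_iff[OF inv\<mu>]) (use ballC in simp_all)
    have "AE z in \<mu>. z \<in> complex_of_real ` {1 / C..C}"
      using pos le ge nz
    proof eventually_elim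
      case (elim z)
      then have z: "z = of_real (Re z)" "cmod z = Re z" by (auto simp: complex_eq_iff cmod_eq_Re)
      have "Re z > 0" using elim z by (metis zero_less_norm_iff)
      then have "1 / C \<le> Re z" using elim z(2) C by (simp add: norm_divide field_simps)
      then show ?case using elim z by (intro image_eqI[of _ _ "Re z"]) auto
    qed
    moreover have "{1 / C..C} \<subseteq> {0<..}" using C by (auto intro: less_le_trans[of 0 "1 / C"])
    ultimately show ?thesis by blast
  qed
  show ?thesis
    unfolding limit_properties_def Let_def taylor_coeff_eq
  proof (intro conjI impI allI)
    fix k :: nat assume k: "k \<ge> 1"
    then have sum: "fps_nth ((1 + fps_X) ^ k * fps_exp (complex_of_real s * of_nat k)) (k - 1) =
       (\<Sum>j=0..k-1. of_nat (k choose (j + 1)) * (complex_of_real s * of_nat k) ^ j / fact j)"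
      using limit_moment_sum[of k s] by (simp add: limit_moment_def)
    show "integrable \<mu> (\<lambda>z. z ^ k)" using mom k by blast
    show "integral\<^sup>L \<mu> (\<lambda>z. z ^ k) = exp (complex_of_real s * of_nat k / 2) / of_nat k *
        fps_nth ((1 + fps_X) ^ k * fps_exp (complex_of_real s * of_nat k)) (k - 1)"
      using mom[OF k] by (simp add: limit_moment_def)
    show "exp (complex_of_real s * of_nat k / 2) / of_nat k *
        fps_nth ((1 + fps_X) ^ k * fps_exp (complex_of_real s * of_nat k)) (k - 1) =
      exp (complex_of_real s * of_nat k / 2) / of_nat k *
        (\<Sum>j=0..k-1. of_nat (k choose (j + 1)) * (complex_of_real s * of_nat k) ^ j / fact j)"
      by (simp only: sum)
    show "exp (complex_of_real s * of_nat k / 2) / of_nat k *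
        (\<Sum>j=0..k-1. of_nat (k choose (j + 1)) * (complex_of_real s * of_nat k) ^ j / fact j) =
      exp (complex_of_real s * of_nat k / 2) / of_nat k * laguerre (k - 1) 1 (- (complex_of_real s * of_nat k))"
      by (simp only: laguerre_eq[OF k])
  qed (use circle compact_supp inv in auto)
qed

theorem theorem2p5:
  fixes s :: real
  shows "\<exists>\<mu> :: complex measure.
    sets \<mu> = sets borel \<and> prob_space \<mu> \<and>
    weakly_converges (\<lambda>n. zero_distr n (mult_hermite n (complex_of_real s / of_nat n))) \<mu> \<and>
    limit_properties s \<mu> \<and>
    (\<forall>\<nu> :: complex measure.
       sets \<nu> = sets borel \<and> prob_space \<nu> \<and> limit_properties s \<nu> \<longrightarrow> \<nu> = \<mu>)"
proof -
  have subseq: "\<exists>(q :: nat \<Rightarrow> nat) \<mu>. strict_mono q \<and> sets \<mu> = sets borel \<and> prob_space \<mu> \<and>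
      weakly_converges (\<lambda>n. hermite_distr s (Suc (r (q n)))) \<mu> \<and> limit_properties s \<mu>"
    if "strict_mono r" for r :: "nat \<Rightarrow> nat"
  proof -
    obtain q :: "nat \<Rightarrow> nat" and \<mu> where q: "strict_mono q" and \<mu>: "sets \<mu> = sets borel" "prob_space \<mu>"
      and weak: "weakly_converges (\<lambda>n. hermite_distr s (Suc (r (q n)))) \<mu>"
      and "distr \<mu> borel (\<lambda>z. 1 / z) = \<mu>" "AE z in \<mu>. z \<noteq> 0"
      and "\<forall>k\<ge>1. integrable \<mu> (\<lambda>z. z ^ k) \<and> integral\<^sup>L \<mu> (\<lambda>z. z ^ k) = limit_moment s k"
      using hermite_subsequence_limit[OF \<open>strict_mono r\<close>, of s] by blast
    then have "limit_properties s \<mu>" by (intro limit_properties_of_limit[OF \<mu> weak]) auto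
    then show ?thesis using q \<mu> weak by blast
  qed
  obtain \<mu> where \<mu>: "sets \<mu> = sets borel" "prob_space \<mu>" "limit_properties s \<mu>"
    using subseq[of id] strict_mono_id by blast
  have "weakly_converges (hermite_distr s) \<mu>"
    unfolding weakly_converges_def
  proof (intro allI impI)
    fix f :: "complex \<Rightarrow> real" assume f: "continuous_on UNIV f \<and> bounded (range f)"
    have "(\<lambda>n. integral\<^sup>L (hermite_distr s (Suc n)) f) \<longlonglongrightarrow> integral\<^sup>L \<mu> f"
    proof (rule tendsto_of_subsubsequences)
      fix r :: "nat \<Rightarrow> nat" assume "strict_mono r"
      from subseq[OF this] obtain q \<nu> where "strict_mono (q :: nat \<Rightarrow> nat)" "sets \<nu> = sets borel" "prob_space \<nu>"
        "weakly_converges (\<lambda>n. hermite_distr s (Suc (r (q n)))) \<nu>" "limit_properties s \<nu>" by blast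
      moreover from this have "\<nu> = \<mu>" using \<mu> limit_properties_unique by blast
      ultimately show "\<exists>q :: nat \<Rightarrow> nat. strict_mono q \<and>
          (\<lambda>n. integral\<^sup>L (hermite_distr s (Suc (r (q n)))) f) \<longlonglongrightarrow> integral\<^sup>L \<mu> f"
        using f by (auto simp: weakly_converges_def)
    qed
    then show "(\<lambda>n. integral\<^sup>L (hermite_distr s n) f) \<longlonglongrightarrow> integral\<^sup>L \<mu> f" by (rule LIMSEQ_imp_Suc)
  qed
  then show ?thesis
    using \<mu> limit_properties_unique unfolding hermite_distr_def[abs_def] by blast
qed

end
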